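(* Let $A\in\mathbb{R}^{m\times n}$, $b\in\mathbb{R}^m$ with the linear system $Ax=b$ consistent, let $r=\operatorname{rank}(A)$ and $1\le s\le r$. Let $\lambda:=(\sigma_1^2(A),\ldots,\sigma_{\min}^2(A),0,\ldots,0)^\top\in\mathbb{R}^m$ and $\rho_{A,s}:=\dfrac{\sigma_{\min}^2(A)}{\sigma_s^2(A)+\cdots+\sigma_{\min}^2(A)}$. Assume $$0<\omega\le\frac{e_s(\lambda)}{e_{s-1}(\lambda_{-m})\|A\|_2^2}\qquad\text{and}\qquad \big(1-\sqrt{\omega\rho_{A,s}}\big)^2<\beta<1.$$ Let $x^0=x^1\in\mathbb{R}^n$ be arbitrary and let $\{x^k\}_{k\ge0}$ be generated by $$x^{k+1}=x^k-\omega A_{\mathcal{S}_k}^\dagger(A_{\mathcal{S}_k}x^k-b_{\mathcal{S}_k})+\beta(x^k-x^{k-1}),\qquad k\ge1,$$ where at each iteration $\mathcal{S}_k\sim\operatorname{Vol}_s(AA^\top)$ is drawn independently of the past. Let $x^0_*:=A^\dagger b+(I-A^\dagger A)x^0$. Then there exists a constant $c>0$ such that for all $k\ge0$, $$\big\|\mathbb{E}[x^k-x^0_*]\big\|_2^2\le\beta^k c .$$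
   Context: $\sigma_1(A)\ge\cdots\ge\sigma_r(A)=:\sigma_{\min}(A)>0$ are the nonzero singular values of $A$; $\|A\|_2=\sigma_1(A)$. For $\xi\in\mathbb{R}^p$ and $1\le\ell\le p$, $e_\ell(\xi):=\sum_{1\le i_1<\cdots<i_\ell\le p}\xi_{i_1}\cdots\xi_{i_\ell}$, and $e_0(\xi):=1$; $\lambda_{-m}\in\mathbb{R}^{m-1}$ is $\lambda$ with its last entry removed. For $\mathcal{S}\subseteq[m]$, $A_{\mathcal{S}}$ and $b_{\mathcal{S}}$ are the row submatrix of $A$ and subvector of $b$ indexed by $\mathcal{S}$, and $\dagger$ denotes the Moore–Penrose pseudoinverse. Volume sampling: $\mathcal{S}\sim\operatorname{Vol}_s(AA^\top)$ means $\mathcal{S}$ takes values in the $s$-element subsets of $[m]$ with $\mathbb{P}(\mathcal{S}=\mathcal{T})=\det(A_{\mathcal{T}}A_{\mathcal{T}}^\top)/\sum_{|\mathcal{J}|=s}\det(A_{\mathcal{J}}A_{\mathcal{J}}^\top)$. *)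

theory Defs
  imports "Jordan_Normal_Form.DL_Rank" "Jordan_Normal_Form.DL_Submatrix"
    "Jordan_Normal_Form.Char_Poly" "HOL-Computational_Algebra.Polynomial"
    "HOL-Library.Multiset"
begin

(* All indices are 0-based: rows of an m x n matrix are {0..<m}. *)

(* lambda = eigenvalues of A A^T in decreasing order, with multiplicity
   (a list of length m); its nonzero entries are sigma_i(A)^2, the rest 0. *)
definition sq_sv_list :: "real mat \<Rightarrow> real list" where
  "sq_sv_list A = rev (sorted_list_of_multiset (proots (char_poly (A * A\<^sup>T))))"

definition mrank :: "real mat \<Rightarrow> nat" where
  "mrank A = vec_space.rank (dim_row A) A"

(* sigma_i(A), 1-based: i-th largest singular value, for 1 <= i <= rank A *)
definition sing_val :: "real mat \<Rightarrow> nat \<Rightarrow> real" where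
  "sing_val A i = sqrt (sq_sv_list A ! (i - 1))"

definition spec_norm :: "real mat \<Rightarrow> real" where
  "spec_norm A = sing_val A 1"

definition elem_sym :: "real list \<Rightarrow> nat \<Rightarrow> real" where
  "elem_sym xs l = (\<Sum>I\<in>{I. I \<subseteq> {0..<length xs} \<and> card I = l}. \<Prod>i\<in>I. xs ! i)"

definition rho :: "real mat \<Rightarrow> nat \<Rightarrow> real" where
  "rho A s = (sing_val A (mrank A))\<^sup>2 / (\<Sum>i=s..mrank A. (sing_val A i)\<^sup>2)"

definition pinv :: "real mat \<Rightarrow> real mat" where
  "pinv A = (THE X. X \<in> carrier_mat (dim_col A) (dim_row A) \<and> A * X * A = A \<and> X * A * X = X
      \<and> (A * X)\<^sup>T = A * X \<and> (X * A)\<^sup>T = X * A)"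

definition row_sub :: "real mat \<Rightarrow> nat set \<Rightarrow> real mat" where
  "row_sub A S = submatrix A S {0..<dim_col A}"

definition vec_sub :: "real vec \<Rightarrow> nat set \<Rightarrow> real vec" where
  "vec_sub b S = vec (card {i. i < dim_vec b \<and> i \<in> S}) (\<lambda>i. b $ pick S i)"

definition subsets_card :: "nat \<Rightarrow> nat \<Rightarrow> nat set set" where
  "subsets_card m s = {T. T \<subseteq> {0..<m} \<and> card T = s}"

definition vol_prob :: "real mat \<Rightarrow> nat \<Rightarrow> nat set \<Rightarrow> real" where
  "vol_prob A s T = det (row_sub A T * (row_sub A T)\<^sup>T) /
      (\<Sum>J\<in>subsets_card (dim_row A) s. det (row_sub A J * (row_sub A J)\<^sup>T))"

(* the iterates x^k for a given realisation S : nat => nat set of S_1, S_2, ... *)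
fun iter_x :: "real mat \<Rightarrow> real vec \<Rightarrow> real \<Rightarrow> real \<Rightarrow> real vec \<Rightarrow> (nat \<Rightarrow> nat set) \<Rightarrow> nat \<Rightarrow> real vec" where
  "iter_x A b \<omega> \<beta> x0 S 0 = x0"
| "iter_x A b \<omega> \<beta> x0 S (Suc 0) = x0"
| "iter_x A b \<omega> \<beta> x0 S (Suc (Suc k)) =
     (let xk = iter_x A b \<omega> \<beta> x0 S (Suc k); xk' = iter_x A b \<omega> \<beta> x0 S k; T = S (Suc k) in
      xk - \<omega> \<cdot>\<^sub>v (pinv (row_sub A T) *\<^sub>v (row_sub A T *\<^sub>v xk - vec_sub b T)) + \<beta> \<cdot>\<^sub>v (xk - xk'))"

(* E[x^k]: x^k depends on S_1..S_{k-1}, drawn i.i.d. from Vol_s(A A^T);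
   the expectation is the finite sum over all realisations (component i). *)
definition exp_iter :: "real mat \<Rightarrow> real vec \<Rightarrow> nat \<Rightarrow> real \<Rightarrow> real \<Rightarrow> real vec \<Rightarrow> nat \<Rightarrow> real vec" where
  "exp_iter A b s \<omega> \<beta> x0 k = vec (dim_col A) (\<lambda>i.
     \<Sum>S\<in>PiE {1..<k} (\<lambda>_. subsets_card (dim_row A) s).
       (\<Prod>j\<in>{1..<k}. vol_prob A s (S j)) * (iter_x A b \<omega> \<beta> x0 S k $ i))"

definition norm2_sq :: "real vec \<Rightarrow> real" where
  "norm2_sq v = (\<Sum>i<dim_vec v. (v $ i)\<^sup>2)"

end

theory Submission
  imports Defs "Jordan_Normal_Form.Schur_Decomposition"
begin

text \<open>
  Write \<open>M = A A\<^sup>T = W D W\<^sup>T\<close> with \<open>W\<close> orthogonal and let \<open>H\<close> be the expectation of the projections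
  \<open>A\<^sub>S\<^sup>\<dagger> A\<^sub>S\<close> under volume sampling. By the matrix determinant lemma, for eigenvectors \<open>w\<^sub>i, w\<^sub>j\<close> of \<open>M\<close>,
  the number \<open>w\<^sub>i\<^sup>T A H A\<^sup>T w\<^sub>j\<close> is, up to normalisation, the change of the sum of the principal
  \<open>s\<close>-minors of \<open>M\<close> under the rank-one update \<open>\<lambda>\<^sub>i \<lambda>\<^sub>j w\<^sub>j w\<^sub>i\<^sup>T\<close>. That sum is a coefficient of the characteristic
  polynomial, so it can be computed for the triangular matrix \<open>D + \<lambda>\<^sub>i \<lambda>\<^sub>j E\<^sub>j\<^sub>i\<close>. Hence \<open>H\<close> is diagonal in the
  basis \<open>A\<^sup>T w\<^sub>i\<close> with eigenvalues \<open>\<mu>\<^sub>i = \<lambda>\<^sub>i e\<^sub>s\<^sub>-\<^sub>1(\<lambda>\<^sub>-\<^sub>i) / e\<^sub>s(\<lambda>)\<close>, and \<open>\<rho> \<le> \<mu>\<^sub>i\<close>, \<open>\<omega> \<mu>\<^sub>i \<le> 1\<close> on the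
  range of \<open>A\<^sup>T\<close>. The expected error stays in that range, and each of its coordinates obeys
  \<open>u\<^sub>k\<^sub>+\<^sub>1 = (1 + \<beta> - \<omega> \<mu>\<^sub>i) u\<^sub>k - \<beta> u\<^sub>k\<^sub>-\<^sub>1\<close>, whose characteristic roots are complex of modulus \<open>\<surd>\<beta>\<close>.
\<close>

section \<open>Elementary symmetric sums and the scalar recursion\<close>

text \<open>Index sets replace lists so that deleting an index or changing a single value can be
  expressed; \<open>elem_sym\<close> is the case of the positions in a list.\<close>

definition esym :: "('i \<Rightarrow> 'a::comm_semiring_1) \<Rightarrow> 'i set \<Rightarrow> nat \<Rightarrow> 'a" where
  "esym f N l = (\<Sum>I\<in>{I. I \<subseteq> N \<and> card I = l}. \<Prod>i\<in>I. f i)"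

lemma elem_sym_eq_esym: "elem_sym xs l = esym (\<lambda>i. xs ! i) {0..<length xs} l"
  by (simp add: elem_sym_def esym_def)

lemma elem_sym_butlast:
  "elem_sym (butlast xs) l = esym (\<lambda>i. xs ! i) {0..<length xs - 1} l"
  unfolding elem_sym_eq_esym esym_def
  by (intro sum.cong prod.cong) (auto simp: nth_butlast)

lemma esym_0: "finite N \<Longrightarrow> esym f N 0 = 1"
proof -
  assume "finite N"
  hence "{I. I \<subseteq> N \<and> card I = 0} = {{}}"
    by (auto dest: finite_subset)
  thus ?thesis by (simp add: esym_def)
qed

lemma esym_cong: "(\<And>i. i \<in> N \<Longrightarrow> f i = g i) \<Longrightarrow> esym f N l = esym g N l"
  unfolding esym_def by (intro sum.cong prod.cong) auto

text \<open>An index set of size \<open>Suc l\<close> either avoids \<open>a\<close> or arises from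
  exactly one set of size \<open>l\<close> by adding \<open>a\<close>.\<close>

lemma esym_insert:
  assumes fin: "finite N" and a: "a \<notin> N"
  shows "esym f (insert a N) (Suc l) = esym f N (Suc l) + f a * esym f N l"
proof -
  let ?S = "\<lambda>N l. {I. I \<subseteq> N \<and> card I = l}"
  have eq: "?S (insert a N) (Suc l) = ?S N (Suc l) \<union> insert a ` ?S N l"
  proof (intro subset_antisym subsetI)
    fix I assume I: "I \<in> ?S (insert a N) (Suc l)"
    show "I \<in> ?S N (Suc l) \<union> insert a ` ?S N l"
    proof (cases "a \<in> I")
      case True
      hence "I = insert a (I - {a})" by auto
      moreover have "I - {a} \<in> ?S N l" using I True by (auto simp: card_Diff_singleton)
      ultimately show ?thesis by blast
    qed (use I in auto)
  next
    fix I assume "I \<in> ?S N (Suc l) \<union> insert a ` ?S N l"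
    moreover have "card (insert a J) = Suc (card J)" if "J \<subseteq> N" for J
      using that a fin by (metis card_insert_disjoint finite_subset subsetD)
    ultimately show "I \<in> ?S (insert a N) (Suc l)" by auto
  qed
  have inj: "inj_on (insert a) (?S N l)"
    using a by (auto simp: inj_on_def)
  have "esym f (insert a N) (Suc l) =
      esym f N (Suc l) + (\<Sum>I\<in>insert a ` ?S N l. \<Prod>i\<in>I. f i)"
    unfolding esym_def eq using fin a
    by (intro sum.union_disjoint) auto
  also have "(\<Sum>I\<in>insert a ` ?S N l. \<Prod>i\<in>I. f i) = (\<Sum>I\<in>?S N l. f a * (\<Prod>i\<in>I. f i))"
    unfolding sum.reindex[OF inj] o_def
    by (intro sum.cong refl prod.insert) (use fin a in \<open>auto dest: finite_subset\<close>)
  finally show ?thesis by (simp add: esym_def sum_distrib_left)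
qed

lemma esym_remove:
  assumes "finite N" and "a \<in> N" and "l \<ge> 1"
  shows "esym f N l = esym f (N - {a}) l + f a * esym f (N - {a}) (l - 1)"
  using esym_insert[of "N - {a}" a f "l - 1"] assms by (simp add: insert_absorb)

text \<open>The sum is affine in each single value, with slope the sum of one degree less over the
  other indices. These slopes are the source of the eigenvalues of the expected projection.\<close>

lemma esym_fun_upd:
  fixes f :: "'i \<Rightarrow> 'a::comm_ring_1"
  assumes "finite N" and "a \<in> N" and "l \<ge> 1"
  shows "esym (f(a := c)) N l - esym f N l = (c - f a) * esym f (N - {a}) (l - 1)"
proof -
  have "esym (f(a := c)) (N - {a}) k = esym f (N - {a}) k" for k
    by (rule esym_cong) auto
  thus ?thesis
    unfolding esym_remove[OF assms] by (simp add: algebra_simps)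
qed

lemma esym_eq_0_if_card_less:
  assumes "finite N" and "card N < l"
  shows "esym f N l = 0"
proof -
  have "{I. I \<subseteq> N \<and> card I = l} = {}"
    using assms by (auto dest: card_mono[rotated])
  thus ?thesis unfolding esym_def by (simp only: sum.empty)
qed

lemma esym_drop_zeros:
  assumes "finite N" and "N' \<subseteq> N" and "\<And>i. i \<in> N - N' \<Longrightarrow> f i = 0"
  shows "esym f N l = esym f N' l"
  unfolding esym_def
proof (rule sum.mono_neutral_right)
  show "\<forall>I\<in>{I. I \<subseteq> N \<and> card I = l} - {I. I \<subseteq> N' \<and> card I = l}. prod f I = 0"
  proof
    fix I assume I: "I \<in> {I. I \<subseteq> N \<and> card I = l} - {I. I \<subseteq> N' \<and> card I = l}"
    then obtain i where "i \<in> I" "i \<in> N - N'" by auto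
    moreover have "finite I" using I assms(1) by (auto dest: finite_subset)
    ultimately show "prod f I = 0" using assms(3) by (intro prod_zero) auto
  qed
qed (use assms in auto)

section \<open>Inequalities for nonnegative values\<close>

context
  fixes f :: "'i \<Rightarrow> real"
  assumes nonneg: "\<And>i. f i \<ge> 0"
begin

lemma esym_nonneg: "esym f N l \<ge> 0"
  unfolding esym_def by (intro sum_nonneg prod_nonneg nonneg)

lemma esym_mono_set: "finite N \<Longrightarrow> N' \<subseteq> N \<Longrightarrow> esym f N' l \<le> esym f N l"
  unfolding esym_def by (intro sum_mono2 prod_nonneg nonneg) auto

text \<open>Splitting off the inserted element leaves a common term over \<open>C\<close>; the other
  terms are \<open>f b\<close> and \<open>f a\<close> times the same nonnegative sum.\<close>

lemma esym_exchange:
  assumes "finite C" and "a \<notin> C" and "b \<notin> C" and "f b \<le> f a"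
  shows "esym f (insert b C) l \<le> esym f (insert a C) l"
proof (cases l)
  case 0 thus ?thesis using assms by (simp add: esym_0)
next
  case (Suc k)
  thus ?thesis using assms esym_nonneg
    by (simp add: esym_insert mult_right_mono)
qed

text \<open>The terms containing both \<open>a\<close> and \<open>b\<close> agree on the two sides,
  and in the rest the weights multiply the same nonnegative sum over \<open>C\<close>. With both
  elements added to \<open>C\<close>, this says that a value times the sum over the remaining
  indices grows with the value.\<close>

lemma esym_exchange_weighted:
  assumes "finite C" and "a \<notin> C" and "b \<notin> C" and "f b \<le> f a"
  shows "f b * esym f (insert a C) l \<le> f a * esym f (insert b C) l"
proof (cases l)
  case 0 thus ?thesis using assms by (simp add: esym_0)
next
  case (Suc k)
  thus ?thesis using assms mult_right_mono[OF assms(4) esym_nonneg[of C l]]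
    by (simp add: esym_insert algebra_simps)
qed

end

text \<open>Every index set of size \<^term>\<open>Suc l\<close> is split at its largest element, which is at least \<^term>\<open>l\<close>.\<close>
lemma esym_le_tail_sum:
  fixes f :: "nat \<Rightarrow> real"
  assumes nonneg: "\<And>i. f i \<ge> 0"
  shows "esym f {0..<p} (Suc l) \<le> esym f {0..<p - 1} l * (\<Sum>i=l..<p. f i)"
proof (induction p)
  case 0
  show ?case by (simp add: esym_eq_0_if_card_less)
next
  case (Suc p)
  show ?case
  proof (cases "l \<le> p")
    case True
    have "esym f {0..<Suc p} (Suc l) = esym f {0..<p} (Suc l) + f p * esym f {0..<p} l"
      by (simp add: atLeast0_lessThan_Suc esym_insert)
    also have "esym f {0..<p} (Suc l) \<le> esym f {0..<p - 1} l * (\<Sum>i=l..<p. f i)"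
      by (rule Suc.IH)
    also have "\<dots> \<le> esym f {0..<p} l * (\<Sum>i=l..<p. f i)"
      by (intro mult_right_mono esym_mono_set sum_nonneg nonneg) auto
    finally show ?thesis using True by (simp add: algebra_simps)
  next
    case False
    thus ?thesis by (simp add: esym_eq_0_if_card_less)
  qed
qed

context
  fixes f :: "nat \<Rightarrow> real" and m s :: nat
  assumes nonneg: "\<And>i. f i \<ge> 0"
    and anti: "\<And>i j. i \<le> j \<Longrightarrow> j < m \<Longrightarrow> f j \<le> f i"
    and s: "s \<ge> 1"
begin

text \<open>Both factors are largest on the right: \<open>f 0\<close> is the largest value, and
  dropping the last, smallest value costs least, by exchange. This serves to bound the step size
  times each eigenvalue by 1.\<close>

lemma weighted_esym_le:
  assumes j: "j < m"
  shows "f j * esym f ({0..<m} - {j}) (s - 1) \<le> f 0 * esym f {0..<m - 1} (s - 1)"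
proof -
  have "esym f ({0..<m} - {j}) (s - 1) \<le> esym f {0..<m - 1} (s - 1)"
  proof (cases "j = m - 1")
    case True
    hence "{0..<m} - {j} = {0..<m - 1}" using j by auto
    thus ?thesis by simp
  next
    case False
    let ?C = "{0..<m} - {j, m - 1}"
    have "{0..<m} - {j} = insert (m - 1) ?C" "{0..<m - 1} = insert j ?C"
      using False j by auto
    moreover have "esym f (insert (m - 1) ?C) (s - 1) \<le> esym f (insert j ?C) (s - 1)"
      by (rule esym_exchange[OF nonneg]) (use anti[of j "m - 1"] j in auto)
    ultimately show ?thesis by simp
  qed
  thus ?thesis
    by (rule mult_mono[OF anti[OF le0 j] _ nonneg esym_nonneg[OF nonneg]])
qed

text \<open>For \<open>j = r - 1\<close> the bound is \<open>esym_le_tail_sum\<close> on the first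
  \<open>r\<close> values, which carry the whole sum; the weighted exchange shows that
  \<open>f j\<close> times the sum over the other indices is smallest there. After division it reads
  \<rho> \<le> \<mu>.\<close>

lemma weighted_esym_ge:
  assumes j: "j < r" and r: "r \<le> m" and zero: "\<And>i. r \<le> i \<Longrightarrow> i < m \<Longrightarrow> f i = 0"
  shows "f (r - 1) * esym f {0..<m} s
    \<le> f j * esym f ({0..<m} - {j}) (s - 1) * (\<Sum>i=s - 1..<r. f i)"
proof -
  let ?e = "\<lambda>j. esym f ({0..<m} - {j}) (s - 1)" and ?S = "\<Sum>i=s - 1..<r. f i"
  have S: "?S \<ge> 0" by (intro sum_nonneg nonneg)
  have "esym f {0..<m} s = esym f {0..<r} s"
    by (rule esym_drop_zeros) (use r zero in auto)
  also have "\<dots> \<le> esym f {0..<r - 1} (s - 1) * ?S"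
    using esym_le_tail_sum[of f r "s - 1", OF nonneg] s by simp
  also have "\<dots> \<le> ?e (r - 1) * ?S"
    by (intro mult_right_mono S esym_mono_set nonneg) (use r j in auto)
  finally have "f (r - 1) * esym f {0..<m} s \<le> f (r - 1) * ?e (r - 1) * ?S"
    unfolding mult.assoc by (rule mult_left_mono[OF _ nonneg])
  also have "\<dots> \<le> f j * ?e j * ?S"
  proof (intro mult_right_mono S)
    show "f (r - 1) * ?e (r - 1) \<le> f j * ?e j"
    proof (cases "j = r - 1")
      case False
      let ?C = "{0..<m} - {j, r - 1}"
      have eq: "{0..<m} - {j} = insert (r - 1) ?C" "{0..<m} - {r - 1} = insert j ?C"
        using False j r by auto
      show ?thesis unfolding eq
        by (rule esym_exchange_weighted[OF nonneg]) (use anti[of j "r - 1"] j r in auto)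
    qed simp
  qed
  finally show ?thesis .
qed

end

section \<open>Scalar recursion with momentum\<close>

lemma heavy_ball_scalar_bound:
  fixes u :: "nat \<Rightarrow> real"
  assumes rec: "\<And>k. u (Suc (Suc k)) = (1 + \<beta> - \<theta>) * u (Suc k) - \<beta> * u k"
    and \<theta>: "0 \<le> \<theta>" "\<theta> \<le> 1" and \<beta>: "(1 - sqrt \<theta>)\<^sup>2 < \<beta>" "\<beta> < 1"
  shows "\<exists>C\<ge>0. \<forall>k. (u k)\<^sup>2 \<le> C * \<beta> ^ k"
proof -
  define a where "a = 1 + \<beta> - \<theta>"
  define Q where "Q k = (u (Suc k))\<^sup>2 - a * u (Suc k) * u k + \<beta> * (u k)\<^sup>2" for k
  have \<beta>0: "\<beta> > 0" using \<beta>(1) by (smt (verit) zero_le_power2)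
  \<comment> \<open>\<^term>\<open>Q\<close> is a quadratic form in two consecutive iterates that the recursion scales by
    \<^term>\<open>\<beta>\<close>; it is positive definite because the characteristic roots are not real.\<close>
  have "Q (Suc k) = \<beta> * Q k" for k
    unfolding Q_def rec a_def[symmetric] by (simp add: power2_eq_square algebra_simps)
  hence Q: "Q k = \<beta> ^ k * Q 0" for k
    by (induction k) auto
  have sq: "sqrt \<theta> \<le> 1" using \<theta> by simp
  \<comment> \<open>Since sqrt \<theta> \<le> 1, this says 1 - sqrt \<beta> < sqrt \<theta>; squared
    it is an upper bound on \<open>a\<close>, which with the lower bound makes the discriminant
    \<open>a\<^sup>2 - 4 * \<beta>\<close> negative.\<close>
  have "\<bar>1 - sqrt \<theta>\<bar> < sqrt \<beta>"
    using \<beta>(1) by (metis real_sqrt_abs real_sqrt_less_iff)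
  hence "(1 - sqrt \<beta>)\<^sup>2 < (sqrt \<theta>)\<^sup>2"
    using \<beta> by (intro power_strict_mono) auto
  hence low: "1 + \<beta> - \<theta> < 2 * sqrt \<beta>"
    using \<beta>0 \<theta> by (simp add: power2_eq_square algebra_simps)
  have "- (2 * sqrt \<beta>) < 1 + \<beta> - \<theta>"
    using \<beta>0 \<theta> real_sqrt_gt_zero[OF \<beta>0] by linarith
  with low have "\<bar>a\<bar> < 2 * sqrt \<beta>" unfolding a_def by linarith
  hence "\<bar>a\<bar>\<^sup>2 < (2 * sqrt \<beta>)\<^sup>2"
    by (intro power_strict_mono) auto
  hence pos: "\<beta> - a\<^sup>2 / 4 > 0" using \<beta>0 by (simp add: power_mult_distrib)
  \<comment> \<open>Completing the square in \<open>u (Suc k)\<close> leaves this multiple of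
    \<open>(u k)\<^sup>2\<close>.\<close>
  have le: "(\<beta> - a\<^sup>2 / 4) * (u k)\<^sup>2 \<le> Q k" for k
  proof -
    have "Q k - (\<beta> - a\<^sup>2 / 4) * (u k)\<^sup>2 = (u (Suc k) - a / 2 * u k)\<^sup>2"
      unfolding Q_def by (simp add: power2_eq_square field_simps)
    thus ?thesis by (smt (verit) zero_le_power2)
  qed
  have "Q 0 \<ge> 0" using le[of 0] pos
    by (smt (verit) mult_nonneg_nonneg zero_le_power2)
  moreover have "(u k)\<^sup>2 \<le> Q 0 / (\<beta> - a\<^sup>2 / 4) * \<beta> ^ k" for k
    using le[of k] pos unfolding Q[of k] by (simp add: field_simps)
  ultimately show ?thesis
    using pos by (intro exI[of _ "Q 0 / (\<beta> - a\<^sup>2 / 4)"]) simp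
qed


section \<open>Sums of principal minors\<close>

text \<open>The matrix determinant lemma. The block matrix \<open>?L\<close> is multiplied by
  unipotent block triangular matrices that clear either its upper right or its lower left block; the
  two resulting determinants are the two sides.\<close>

lemma det_one_plus_rank_one:
  fixes z v :: "'a::idom vec"
  assumes z: "z \<in> carrier_vec n" and v: "v \<in> carrier_vec n"
  shows "det (1\<^sub>m n + mat n n (\<lambda>(i, j). z $ i * v $ j)) = 1 + v \<bullet> z"
proof -
  define Z where "Z = mat n 1 (\<lambda>(i, j). z $ i)"
  define V where "V = mat 1 n (\<lambda>(i, j). v $ j)"
  have Z: "Z \<in> carrier_mat n 1" and V: "V \<in> carrier_mat 1 n"
    by (auto simp: Z_def V_def)
  have ZV: "Z * V = mat n n (\<lambda>(i, j). z $ i * v $ j)"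
    by (rule eq_matI) (auto simp: Z_def V_def scalar_prod_def)
  let ?L = "four_block_mat (1\<^sub>m 1) (- V) Z (1\<^sub>m n)"
  let ?U = "four_block_mat (1\<^sub>m 1) V (0\<^sub>m n 1) (1\<^sub>m n)"
  let ?U' = "four_block_mat (1\<^sub>m 1) (0\<^sub>m 1 n) (- Z) (1\<^sub>m n)"
  have L: "?L \<in> carrier_mat (1 + n) (1 + n)"
    by (rule four_block_carrier_mat) auto
  have "det ?L = det ?L * det ?U"
    by (subst det_four_block_mat_lower_left_zero[of _ 1 _ n]) (use V in auto)
  also have "\<dots> = det (?L * ?U)"
    by (rule det_mult[symmetric, OF L]) (rule four_block_carrier_mat; auto)
  also have "?L * ?U = four_block_mat (1\<^sub>m 1) (0\<^sub>m 1 n) Z (Z * V + 1\<^sub>m n)"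
    by (subst mult_four_block_mat[of _ 1 1 _ n _ n _ _ 1 _ n]) (use V Z in auto)
  also have "det \<dots> = det (Z * V + 1\<^sub>m n)"
    by (subst det_four_block_mat_upper_right_zero[of _ 1 _ n]) (use V Z in auto)
  finally have 1: "det ?L = det (Z * V + 1\<^sub>m n)" .
  have "det ?L = det ?L * det ?U'"
    by (subst det_four_block_mat_upper_right_zero[of _ 1 _ n]) (use Z in auto)
  also have "\<dots> = det (?L * ?U')"
    by (rule det_mult[symmetric, OF L]) (rule four_block_carrier_mat; auto)
  also have "?L * ?U' = four_block_mat (1\<^sub>m 1 + V * Z) (- V) (0\<^sub>m n 1) (1\<^sub>m n)"
    by (subst mult_four_block_mat[of _ 1 1 _ n _ n _ _ 1 _ n]) (use V Z in auto)
  also have "det \<dots> = det (1\<^sub>m 1 + V * Z)"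
    by (subst det_four_block_mat_lower_left_zero[of _ 1 _ n]) (use V Z in auto)
  also have "\<dots> = 1 + v \<bullet> z"
    using z by (subst det_single) (auto simp: V_def Z_def scalar_prod_def)
  finally show ?thesis
    using 1 unfolding ZV by (simp add: comm_add_mat[of _ n n])
qed

text \<open>Principal minors as Leibniz sums over the permutations of the index set itself, which avoids
  renumbering rows and columns.\<close>
definition pminor :: "'a::comm_ring_1 mat \<Rightarrow> nat set \<Rightarrow> 'a" where
  "pminor N T = (\<Sum>p\<in>{p. p permutes T}. signof p * (\<Prod>i\<in>T. N $$ (i, p i)))"

definition sum_pminors :: "'a::comm_ring_1 mat \<Rightarrow> nat \<Rightarrow> 'a" where
  "sum_pminors N k = (\<Sum>T\<in>{T. T \<subseteq> {0..<dim_row N} \<and> card T = k}. pminor N T)"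

lemma bij_betw_pick:
  assumes "finite T"
  shows "bij_betw (pick T) {0..<card T} T"
proof -
  have inj: "inj_on (pick T) {0..<card T}"
    by (rule strict_mono_on_imp_inj_on) (auto simp: strict_mono_on_def intro: pick_mono)
  moreover have "pick T ` {0..<card T} \<subseteq> T"
    using pick_in_set by auto
  ultimately show ?thesis
    unfolding bij_betw_def using card_image[OF inj] assms by (simp add: card_subset_eq)
qed

text \<open>Conjugation with the increasing enumeration \<open>pick T\<close> carries the
  permutations of the positions to those of \<open>T\<close> and preserves signs, so the two Leibniz
  sums agree term by term.\<close>

lemma det_submatrix_eq_pminor:
  assumes N: "N \<in> carrier_mat m m" and T: "T \<subseteq> {0..<m}"
  shows "det (submatrix N T T) = pminor N T"
proof -
  let ?s = "card T"
  have fin: "finite T" using T by (rule finite_subset) simp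
  have eqT: "{i. i < m \<and> i \<in> T} = T" using T by auto
  have bij: "bij_betw (pick T) {0..<?s} T" by (rule bij_betw_pick[OF fin])
  hence img: "pick T ` {0..<?s} = T" and inj: "inj_on (pick T) {0..<?s}"
    by (auto simp: bij_betw_def)
  let ?F = "map_permutation {0..<?s} (pick T)"
  have bijF: "bij_betw ?F {p. p permutes {0..<?s}} {p. p permutes T}"
    using bij_betw_permutations[OF bij]
    by (subst bij_betw_cong[where g = "\<lambda>p x. if x \<in> T then pick T (p (inv_into {0..<?s} (pick T) x)) else x"])
      (auto simp: map_permutation_def restrict_id_def img)
  have sub: "submatrix N T T \<in> carrier_mat ?s ?s"
    using N eqT by (auto simp: submatrix_def)
  have "pminor N T = (\<Sum>p\<in>{p. p permutes {0..<?s}}. signof (?F p) * (\<Prod>i\<in>T. N $$ (i, ?F p i)))"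
    unfolding pminor_def by (rule sum.reindex_bij_betw[OF bijF, symmetric])
  also have "\<dots> = (\<Sum>p\<in>{p. p permutes {0..<?s}}. signof p * (\<Prod>i=0..<?s. submatrix N T T $$ (i, p i)))"
  proof (intro sum.cong refl)
    fix p assume "p \<in> {p. p permutes {0..<?s}}"
    hence p: "p permutes {0..<?s}" by simp
    have "(\<Prod>i\<in>T. N $$ (i, ?F p i)) = (\<Prod>i=0..<?s. N $$ (pick T i, ?F p (pick T i)))"
      by (rule prod.reindex_bij_betw[OF bij, symmetric])
    also have "\<dots> = (\<Prod>i=0..<?s. submatrix N T T $$ (i, p i))"
    proof (intro prod.cong refl)
      fix i assume i: "i \<in> {0..<?s}"
      hence "p i \<in> {0..<?s}" using permutes_in_image[OF p] by simp
      thus "N $$ (pick T i, ?F p (pick T i)) = submatrix N T T $$ (i, p i)"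
        using i N eqT map_permutation_apply[OF inj i]
        by (subst submatrix_index) auto
    qed
    finally show "signof (?F p) * (\<Prod>i\<in>T. N $$ (i, ?F p i)) =
        signof p * (\<Prod>i=0..<?s. submatrix N T T $$ (i, p i))"
      using sign_map_permutation[OF inj p] by simp
  qed
  finally show ?thesis unfolding det_def'[OF sub] by simp
qed

text \<open>Expanding each Leibniz product chooses a set \<open>T\<close> of rows that take their
  entry from \<open>N\<close>. Every other row must be fixed by the permutation to contribute
  \<open>t\<close>, so exactly the permutations of \<open>T\<close> survive.\<close>

lemma det_smult_one_plus:
  assumes N: "N \<in> carrier_mat m m"
  shows "det (t \<cdot>\<^sub>m 1\<^sub>m m + N) = (\<Sum>k\<le>m. sum_pminors N k * t ^ (m - k))"
proof -
  let ?U = "{0..<m}" and ?P = "{p. p permutes {0..<m}}"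
  let ?t = "\<lambda>p i. if p i = i then t else 0"
  have "det (t \<cdot>\<^sub>m 1\<^sub>m m + N) = (\<Sum>p\<in>?P. signof p * (\<Prod>i\<in>?U. N $$ (i, p i) + ?t p i))"
  proof (subst det_def'[of _ m], use N in simp, intro sum.cong refl arg_cong2[of _ _ _ _ times] prod.cong)
    fix p i assume "p \<in> ?P" "i \<in> ?U"
    hence "p i < m" "i < m" using permutes_in_image[of p ?U i] by auto
    thus "(t \<cdot>\<^sub>m 1\<^sub>m m + N) $$ (i, p i) = N $$ (i, p i) + ?t p i"
      using N by auto
  qed
  also have "\<dots> = (\<Sum>p\<in>?P. \<Sum>T\<in>Pow ?U. signof p * ((\<Prod>i\<in>T. N $$ (i, p i)) * (\<Prod>i\<in>?U - T. ?t p i)))"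
    by (subst prod_add) (simp_all add: sum_distrib_left)
  also have "\<dots> = (\<Sum>T\<in>Pow ?U. \<Sum>p\<in>?P. signof p * ((\<Prod>i\<in>T. N $$ (i, p i)) * (\<Prod>i\<in>?U - T. ?t p i)))"
    by (rule sum.swap)
  also have "\<dots> = (\<Sum>T\<in>Pow ?U. pminor N T * t ^ (m - card T))"
  proof (intro sum.cong refl)
    fix T assume "T \<in> Pow ?U"
    hence T: "T \<subseteq> ?U" by simp
    hence cardT: "card (?U - T) = m - card T"
      by (subst card_Diff_subset) (auto dest: finite_subset)
    have "(\<Sum>p\<in>?P. signof p * ((\<Prod>i\<in>T. N $$ (i, p i)) * (\<Prod>i\<in>?U - T. ?t p i))) =
        (\<Sum>p\<in>{p. p permutes T}. signof p * ((\<Prod>i\<in>T. N $$ (i, p i)) * (\<Prod>i\<in>?U - T. ?t p i)))"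
    proof (rule sum.mono_neutral_right)
      show "finite ?P" by (simp add: finite_permutations)
      show "{p. p permutes T} \<subseteq> ?P" using permutes_subset[OF _ T] by auto
      show "\<forall>p\<in>?P - {p. p permutes T}.
          signof p * ((\<Prod>i\<in>T. N $$ (i, p i)) * (\<Prod>i\<in>?U - T. ?t p i)) = 0"
      proof
        fix p assume p: "p \<in> ?P - {p. p permutes T}"
        hence "\<exists>i\<in>?U - T. p i \<noteq> i"
          using permutes_superset[of p ?U T] by blast
        hence "(\<Prod>i\<in>?U - T. ?t p i) = 0"
          by (intro prod_zero) auto
        thus "signof p * ((\<Prod>i\<in>T. N $$ (i, p i)) * (\<Prod>i\<in>?U - T. ?t p i)) = 0"
          by simp
      qed
    qed
    also have "\<dots> = (\<Sum>p\<in>{p. p permutes T}. signof p * (\<Prod>i\<in>T. N $$ (i, p i)) * t ^ (m - card T))"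
    proof (intro sum.cong refl)
      fix p assume "p \<in> {p. p permutes T}"
      hence "(\<Prod>i\<in>?U - T. ?t p i) = (\<Prod>i\<in>?U - T. t)"
        by (intro prod.cong refl) (auto simp: permutes_not_in)
      thus "signof p * ((\<Prod>i\<in>T. N $$ (i, p i)) * (\<Prod>i\<in>?U - T. ?t p i)) =
          signof p * (\<Prod>i\<in>T. N $$ (i, p i)) * t ^ (m - card T)"
        by (simp add: cardT mult.assoc)
    qed
    finally show "(\<Sum>p\<in>?P. signof p * ((\<Prod>i\<in>T. N $$ (i, p i)) * (\<Prod>i\<in>?U - T. ?t p i))) =
        pminor N T * t ^ (m - card T)"
      by (simp add: pminor_def sum_distrib_right)
  qed
  also have "\<dots> = (\<Sum>k\<le>m. \<Sum>T\<in>{T \<in> Pow ?U. card T = k}. pminor N T * t ^ (m - card T))"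
    by (rule sum.group[symmetric]) (auto intro: subset_eq_atLeast0_lessThan_card)
  also have "\<dots> = (\<Sum>k\<le>m. sum_pminors N k * t ^ (m - k))"
    using N by (intro sum.cong refl) (simp add: sum_pminors_def sum_distrib_right)
  finally show ?thesis .
qed

lemma prod_add_const_eq_esym:
  fixes f :: "nat \<Rightarrow> 'a::comm_semiring_1"
  shows "(\<Prod>i=0..<m. t + f i) = (\<Sum>k\<le>m. esym f {0..<m} k * t ^ (m - k))"
proof -
  let ?U = "{0..<m}"
  have "(\<Prod>i=0..<m. t + f i) = (\<Prod>i\<in>?U. f i + t)" by (simp add: add.commute)
  also have "\<dots> = (\<Sum>T\<in>Pow ?U. prod f T * t ^ (m - card T))"
  proof (subst prod_add, simp, intro sum.cong refl)
    fix T assume "T \<in> Pow ?U"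
    hence "card (?U - T) = m - card T"
      by (subst card_Diff_subset) (auto dest: finite_subset)
    thus "prod f T * (\<Prod>x\<in>?U - T. t) = prod f T * t ^ (m - card T)" by simp
  qed
  also have "\<dots> = (\<Sum>k\<le>m. \<Sum>T\<in>{T \<in> Pow ?U. card T = k}. prod f T * t ^ (m - card T))"
    by (rule sum.group[symmetric]) (auto intro: subset_eq_atLeast0_lessThan_card)
  also have "\<dots> = (\<Sum>k\<le>m. esym f ?U k * t ^ (m - k))"
    by (intro sum.cong refl) (simp add: esym_def sum_distrib_right)
  finally show ?thesis .
qed

text \<open>Similarity preserves the determinant of \<open>N\<close> shifted by \<open>t\<close>,
  which for a triangular matrix is the product of the shifted diagonal entries; the claim follows by
  comparing coefficients in \<open>t\<close>. The lower triangular case occurs for updates below the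
  diagonal.\<close>

lemma sum_pminors_similar_triangular:
  fixes N :: "real mat"
  assumes sim: "similar_mat N B" and B: "B \<in> carrier_mat m m"
    and tri: "upper_triangular B \<or> upper_triangular B\<^sup>T" and k: "k \<le> m"
  shows "sum_pminors N k = esym (\<lambda>i. B $$ (i, i)) {0..<m} k"
proof -
  obtain P Q where PQ: "similar_mat_wit N B P Q" using sim by (auto simp: similar_mat_def)
  from similar_mat_witD2[OF _ similar_mat_wit_sym[OF PQ], of m m] B
  have N: "N \<in> carrier_mat m m" and P: "P \<in> carrier_mat m m" and Q: "Q \<in> carrier_mat m m"
    and PQ1: "P * Q = 1\<^sub>m m" and NB: "N = P * B * Q"
    using similar_mat_witD[OF _ PQ, of m] by (auto simp: similar_mat_wit_def Let_def)
  have det: "det (t \<cdot>\<^sub>m 1\<^sub>m m + N) = (\<Prod>i=0..<m. t + B $$ (i, i))" for t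
  proof -
    let ?C = "t \<cdot>\<^sub>m 1\<^sub>m m + B"
    have C: "?C \<in> carrier_mat m m" using B by simp
    have "P * ?C * Q = P * (t \<cdot>\<^sub>m 1\<^sub>m m) * Q + P * B * Q"
      unfolding mult_add_distrib_mat[OF P smult_carrier_mat[OF one_carrier_mat] B]
      by (rule add_mult_distrib_mat[OF _ _ Q]) (use P B in auto)
    also have "P * (t \<cdot>\<^sub>m 1\<^sub>m m) * Q = t \<cdot>\<^sub>m 1\<^sub>m m"
      unfolding mult_smult_distrib[OF P one_carrier_mat] right_mult_one_mat[OF P]
        mult_smult_assoc_mat[OF P Q] PQ1 ..
    finally have "det (t \<cdot>\<^sub>m 1\<^sub>m m + N) = det (P * ?C * Q)" using NB by simp
    also have "\<dots> = det P * det ?C * det Q"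
      using P Q C by (simp add: det_mult[of _ m])
    also have "\<dots> = det (P * Q) * det ?C"
      using P Q by (simp add: det_mult[of _ m])
    also have "\<dots> = det ?C" using PQ1 by simp
    also have "\<dots> = prod_list (diag_mat ?C)"
      using tri
    proof
      assume "upper_triangular B"
      hence "upper_triangular ?C" using B by (auto simp: upper_triangular_def)
      thus ?thesis by (rule det_upper_triangular[OF _ C])
    next
      assume "upper_triangular B\<^sup>T"
      hence "B $$ (i, j) = 0" if "i < j" "j < m" for i j
        using that B by (auto simp: upper_triangular_def)
      thus ?thesis using B by (intro det_lower_triangular[OF _ C]) auto
    qed
    also have "\<dots> = (\<Prod>i=0..<m. t + B $$ (i, i))"
      using B by (subst prod_list_diag_prod) auto
    finally show ?thesis .
  qed
  \<comment> \<open>The powers are put in ascending order so that coefficients can be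
    compared.\<close>
  have flip: "(\<Sum>k\<le>m. c k * t ^ (m - k)) = (\<Sum>k\<le>m. c (m - k) * t ^ k)" for c :: "nat \<Rightarrow> real" and t
    by (rule sum.reindex_bij_witness[of _ "\<lambda>k. m - k" "\<lambda>k. m - k"]) auto
  have "\<forall>i\<le>m. sum_pminors N (m - i) = esym (\<lambda>i. B $$ (i, i)) {0..<m} (m - i)"
    unfolding polyfun_eq_coeffs[symmetric]
    using det unfolding det_smult_one_plus[OF N] prod_add_const_eq_esym flip by simp
  from this[rule_format, of "m - k"] k show ?thesis by simp
qed


section \<open>The spectral theorem for real symmetric matrices\<close>

text \<open>Dimensions given as equations leave no intermediate size to be guessed when the law is
  used for rewriting; the next two laws have this form for the same reason.\<close>

lemma mat_mult_assoc_dim: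
  "dim_col A = dim_row B \<Longrightarrow> dim_col B = dim_row C \<Longrightarrow>
    A * B * C = A * (B * (C :: 'a :: semiring_0 mat))"
  by (rule assoc_mult_mat[of _ "dim_row A" "dim_col A" _ "dim_col B" _ "dim_col C"]) auto

lemma transpose_mult_dim:
  "dim_col A = dim_row B \<Longrightarrow> (A * B)\<^sup>T = B\<^sup>T * (A :: 'a :: comm_semiring_0 mat)\<^sup>T"
  by (rule transpose_mult[of _ "dim_row A" "dim_col A" _ "dim_col B"]) auto

lemma one_mult_mat_dim:
  "dim_row A = n \<Longrightarrow> 1\<^sub>m n * A = (A :: 'a :: semiring_1 mat)"
  "dim_col A = n \<Longrightarrow> A * 1\<^sub>m n = A"
  by (auto intro: left_mult_one_mat[of _ _ "dim_col A"] right_mult_one_mat[of _ "dim_row A"])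

text \<open>Moving the self-adjoint matrix across the Hermitian product turns \<open>a\<close> into
  its conjugate, and the product of an eigenvector with itself is nonzero.\<close>

lemma eigenvalue_symmetric_real:
  assumes M: "M \<in> carrier_mat n n" and sym: "M\<^sup>T = M"
    and ev: "eigenvalue (map_mat complex_of_real M) a"
  shows "a \<in> \<real>"
proof -
  let ?M = "map_mat complex_of_real M"
  have Mc: "?M \<in> carrier_mat n n" using M by simp
  obtain v where v: "v \<in> carrier_vec n" and v0: "v \<noteq> 0\<^sub>v n" and Mv: "?M *\<^sub>v v = a \<cdot>\<^sub>v v"
    using ev M unfolding eigenvalue_def eigenvector_def by auto
  have symc: "?M\<^sup>T = ?M" using sym by (metis map_mat_transpose)
  have conj: "conjugate (?M *\<^sub>v v) = ?M *\<^sub>v conjugate v"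
    using M v by (intro eq_vecI) (auto simp: scalar_prod_def sum_conjugate)
  have cv: "conjugate v \<in> carrier_vec n" using v by simp
  have "a * (v \<bullet>c v) = (?M *\<^sub>v v) \<bullet>c v"
    unfolding Mv using v by simp
  also have "\<dots> = v \<bullet> (?M *\<^sub>v conjugate v)"
    using transpose_vec_mult_scalar[OF Mc cv v] unfolding symc .
  also have "\<dots> = v \<bullet> conjugate (a \<cdot>\<^sub>v v)" unfolding conj[symmetric] Mv ..
  also have "\<dots> = cnj a * (v \<bullet>c v)"
    using v by (simp add: conjugate_smult_vec)
  finally have "a = cnj a"
    using conjugate_square_eq_0_vec[OF v] v0 by simp
  thus ?thesis by (simp add: Reals_cnj_iff)
qed

text \<open>Over the complex numbers the polynomial splits; its roots are eigenvalues, hence real,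
  and the embedding of real polynomials is injective.\<close>

lemma char_poly_symmetric_factorized:
  fixes M :: "real mat"
  assumes M: "M \<in> carrier_mat n n" and sym: "M\<^sup>T = M"
  obtains es where "char_poly M = (\<Prod>e\<leftarrow>es. [:- e, 1:])" and "length es = n"
proof -
  let ?M = "map_mat complex_of_real M"
  have Mc: "?M \<in> carrier_mat n n" using M by simp
  obtain as where as: "char_poly ?M = (\<Prod>a\<leftarrow>as. [:- a, 1:])" "length as = n"
    using char_poly_factorized[OF Mc] by auto
  have real: "a \<in> \<real>" if "a \<in> set as" for a
  proof (rule eigenvalue_symmetric_real[OF M sym])
    show "eigenvalue ?M a"
      unfolding eigenvalue_root_char_poly[OF Mc] as(1)
      using that by (auto simp: poly_prod_list prod_list_zero_iff)
  qed
  interpret h: map_poly_inj_comm_ring_hom complex_of_real ..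
  have "map_poly complex_of_real (char_poly M) = char_poly ?M"
    by (rule of_real_hom.char_poly_hom[OF M, symmetric])
  also have "\<dots> = (\<Prod>a\<leftarrow>as. map_poly complex_of_real [:- Re a, 1:])"
    unfolding as(1) using real
    by (intro arg_cong[of _ _ prod_list] map_cong refl) (auto simp: complex_is_Real_iff complex_eq_iff)
  also have "\<dots> = map_poly complex_of_real (\<Prod>e\<leftarrow>map Re as. [:- e, 1:])"
    by (simp add: h.hom_prod_list o_def)
  finally have "char_poly M = (\<Prod>e\<leftarrow>map Re as. [:- e, 1:])"
    by (simp only: h.eq_iff)
  thus ?thesis using that[of "map Re as"] as(2) by simp
qed

text \<open>The vector is completed to a basis. Gram-Schmidt keeps the first vector, and normalising
  the result only rescales it.\<close>

lemma orthogonal_mat_with_first_col: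
  fixes v :: "real vec"
  assumes v: "v \<in> carrier_vec n" and v0: "v \<noteq> 0\<^sub>v n"
  obtains W c where "W \<in> carrier_mat n n" and "W\<^sup>T * W = 1\<^sub>m n" and "col W 0 = c \<cdot>\<^sub>v v"
proof -
  interpret cof_vec_space n "TYPE(real)" .
  define b where "b = basis_completion v"
  define ws where "ws = gram_schmidt n b"
  from basis_completion[OF v v0, folded b_def]
  have dist_b: "distinct b" and indep: "\<not> lin_dep (set b)" and b: "set b \<subseteq> carrier_vec n"
    and hdb: "hd b = v" and len_b: "length b = n" by auto
  have n: "n \<noteq> 0" using v v0 by auto
  from hdb len_b n obtain vs where bv: "b = v # vs" by (cases b) auto
  from gram_schmidt_result[OF b dist_b indep refl, folded ws_def]
  have ws: "set ws \<subseteq> carrier_vec n" "corthogonal ws" "length ws = n"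
    by (auto simp: len_b)
  from gram_schmidt_hd[OF v, of vs, folded bv] have hdws: "hd ws = v" unfolding ws_def .
  define c where "c w = 1 / sqrt (w \<bullet> w)" for w :: "real vec"
  define W where "W = mat_of_cols n (map (\<lambda>w. c w \<cdot>\<^sub>v w) ws)"
  have W: "W \<in> carrier_mat n n" using ws(3) by (auto simp: W_def)
  have wsi: "ws ! i \<in> carrier_vec n" if "i < n" for i using that ws by auto
  have colW: "col W i = c (ws ! i) \<cdot>\<^sub>v ws ! i" if "i < n" for i
    using that ws wsi[OF that] by (simp add: W_def)
  \<comment> \<open>Over the reals conjugation is trivial, so \<open>corthogonal\<close> means
    ordinary orthogonality.\<close>
  have self: "conjugate w = w" for w :: "real vec" by (intro eq_vecI) auto
  have orth: "(ws ! i \<bullet> ws ! j = 0) \<longleftrightarrow> i \<noteq> j" if "i < n" "j < n" for i j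
    using corthogonalD[OF ws(2), of i j] that ws(3) by (simp add: self)
  have "W\<^sup>T * W = 1\<^sub>m n"
  proof (rule eq_matI)
    fix i j assume "i < dim_row (1\<^sub>m n)" "j < dim_col (1\<^sub>m n)"
    hence ij: "i < n" "j < n" by auto
    have "(W\<^sup>T * W) $$ (i, j) = c (ws ! i) * c (ws ! j) * (ws ! i \<bullet> ws ! j)"
      using W ij wsi[OF ij(1)] wsi[OF ij(2)] by (simp add: colW)
    also have "\<dots> = 1\<^sub>m n $$ (i, j)"
    proof (cases "i = j")
      case True
      have "ws ! j \<bullet> ws ! j \<ge> 0" by (simp add: scalar_prod_def sum_nonneg)
      moreover have "ws ! j \<bullet> ws ! j \<noteq> 0" using orth[of j j] ij by simp
      ultimately show ?thesis using True ij by (simp add: c_def)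
    next
      case False
      thus ?thesis using orth[OF ij] ij by simp
    qed
    finally show "(W\<^sup>T * W) $$ (i, j) = 1\<^sub>m n $$ (i, j)" .
  qed (use W in auto)
  moreover have "ws ! 0 = v" using hdws ws(3) n by (cases ws) auto
  ultimately show ?thesis using that[OF W] colW[of 0] n by simp
qed

definition diag_of :: "'a::zero list \<Rightarrow> 'a mat" where
  "diag_of xs = mat (length xs) (length xs) (\<lambda>(i, j). if i = j then xs ! i else 0)"

lemma dim_diag_of [simp]: "dim_row (diag_of xs) = length xs" "dim_col (diag_of xs) = length xs"
  by (simp_all add: diag_of_def)

lemma diag_of_carrier [simp]: "diag_of xs \<in> carrier_mat (length xs) (length xs)"
  by (simp add: diag_of_def)

text \<open>Deflation by induction: an eigenvector for the first root becomes the first column of an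
  orthogonal matrix, and conjugation splits off a 1 by 1 block. The prescribed order of
  \<open>es\<close> is kept, so that the diagonal can be matched with a sorted list.\<close>

lemma spectral_theorem_symmetric:
  fixes M :: "real mat"
  assumes "M \<in> carrier_mat n n" and "M\<^sup>T = M"
    and "char_poly M = (\<Prod>e\<leftarrow>es. [:- e, 1:])" and "length es = n"
  shows "\<exists>W \<in> carrier_mat n n. W\<^sup>T * W = 1\<^sub>m n \<and> W\<^sup>T * M * W = diag_of es"
  using assms
proof (induction es arbitrary: n M)
  case Nil
  thus ?case by (intro bexI[of _ "1\<^sub>m 0"]) (auto simp: diag_of_def)
next
  case (Cons e es n M)
  define k where "k = length es"
  have n: "n = Suc k" and len: "length es = k" using Cons.prems by (auto simp: k_def)
  note M = Cons.prems(1) and sym = Cons.prems(2)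
  have "eigenvalue M e"
    unfolding eigenvalue_root_char_poly[OF M] Cons.prems(3) by simp
  then obtain v where v: "v \<in> carrier_vec n" and v0: "v \<noteq> 0\<^sub>v n" and Mv: "M *\<^sub>v v = e \<cdot>\<^sub>v v"
    using M unfolding eigenvalue_def eigenvector_def by auto
  obtain W c where W: "W \<in> carrier_mat n n" and WW: "W\<^sup>T * W = 1\<^sub>m n" and W0: "col W 0 = c \<cdot>\<^sub>v v"
    using orthogonal_mat_with_first_col[OF v v0] by metis
  have WT: "W\<^sup>T \<in> carrier_mat n n" using W by simp
  have WW': "W * W\<^sup>T = 1\<^sub>m n" using mat_mult_left_right_inverse[OF WT W WW] .
  define A where "A = W\<^sup>T * M * W"
  have A: "A \<in> carrier_mat n n" using W M by (simp add: A_def)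
  have symA: "A\<^sup>T = A"
  proof -
    have "A\<^sup>T = W\<^sup>T * (W\<^sup>T * M)\<^sup>T"
      unfolding A_def by (rule transpose_mult[of _ n n]) (use W M in auto)
    also have "(W\<^sup>T * M)\<^sup>T = M * W"
      using transpose_mult[OF WT M] W sym by simp
    finally show ?thesis unfolding A_def using assoc_mult_mat[OF WT M W] by simp
  qed
  have A0: "A $$ (i, 0) = (if i = 0 then e else 0)" if "i < n" for i
  proof -
    have "A = W\<^sup>T * (M * W)" unfolding A_def by (rule assoc_mult_mat[OF WT M W])
    hence "A $$ (i, 0) = col W i \<bullet> col (M * W) 0"
      using that W M n by simp
    also have "col (M * W) 0 = M *\<^sub>v col W 0"
      by (rule col_mult2[OF M W]) (simp add: n)
    also have "M *\<^sub>v col W 0 = e \<cdot>\<^sub>v col W 0"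
      unfolding W0 using mult_mat_vec[OF M v, of c] Mv
      by (simp add: smult_smult_assoc mult.commute)
    also have "col W i \<bullet> (e \<cdot>\<^sub>v col W 0) = e * (W\<^sup>T * W) $$ (i, 0)"
      using that W n by simp
    finally show ?thesis unfolding WW using that n by simp
  qed
  define B where "B = mat k k (\<lambda>(i, j). A $$ (Suc i, Suc j))"
  have B: "B \<in> carrier_mat k k" by (simp add: B_def)
  let ?e = "mat 1 1 (\<lambda>_. e)"
  have AB: "A = four_block_mat ?e (0\<^sub>m 1 k) (0\<^sub>m k 1) B"
  proof (rule eq_matI)
    fix i j assume "i < dim_row (four_block_mat ?e (0\<^sub>m 1 k) (0\<^sub>m k 1) B)"
      "j < dim_col (four_block_mat ?e (0\<^sub>m 1 k) (0\<^sub>m k 1) B)"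
    hence ij: "i < n" "j < n" using n B by auto
    \<comment> \<open>Symmetry carries the zeros of the first column to the first row.\<close>
    have "A $$ (i, j) = A $$ (j, i)" using symA ij A by (metis carrier_matD index_transpose_mat(1))
    thus "A $$ (i, j) = four_block_mat ?e (0\<^sub>m 1 k) (0\<^sub>m k 1) B $$ (i, j)"
      using ij A0[of i] A0[of j] n B by (cases i; cases j) (auto simp: B_def)
  qed (use A n B in auto)
  have symB: "B\<^sup>T = B"
    using symA A n unfolding B_def
    by (intro eq_matI) (auto, metis Suc_less_eq carrier_matD index_transpose_mat(1))
  have "similar_mat A M" unfolding similar_mat_def
    by (intro exI[of _ "W\<^sup>T"] exI[of _ W] similar_mat_witI[of _ _ n]) (use W WT M A WW WW' A_def in auto)
  hence "char_poly M = char_poly A" by (metis char_poly_similar)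
  also have "\<dots> = char_poly ?e * char_poly B"
    unfolding AB by (rule char_poly_four_block_zeros_col) (use B in auto)
  also have "char_poly ?e = [:- e, 1:]"
    by (simp add: char_poly_defs det_def sign_def)
  \<comment> \<open>The factor of the eigenvalue split off cancels, so the smaller block has the
    remaining roots.\<close>
  finally have "char_poly B = (\<Prod>e\<leftarrow>es. [:- e, 1:])"
    using Cons.prems(3) by (simp only: list.map prod_list.Cons mult_cancel_left) auto
  from Cons.IH[OF B symB this len] obtain V where V: "V \<in> carrier_mat k k"
    and VV: "V\<^sup>T * V = 1\<^sub>m k" and VBV: "V\<^sup>T * B * V = diag_of es" by auto
  let ?V = "four_block_mat (1\<^sub>m 1) (0\<^sub>m 1 k) (0\<^sub>m k 1) V"
  have V': "?V \<in> carrier_mat n n" using V n by auto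
  have VT: "?V\<^sup>T = four_block_mat (1\<^sub>m 1) (0\<^sub>m 1 k) (0\<^sub>m k 1) V\<^sup>T"
    using V by (subst transpose_four_block_mat[of _ 1 1 _ k _ k]) auto
  have VV': "?V\<^sup>T * ?V = 1\<^sub>m n"
    unfolding VT using V VV n
    by (subst mult_four_block_mat[of _ 1 1 _ k _ k _ _ 1 _ k]) (auto simp: four_block_one_mat)
  have VAV: "?V\<^sup>T * A * ?V = diag_of (e # es)"
  proof -
    have "?V\<^sup>T * A = four_block_mat ?e (0\<^sub>m 1 k) (0\<^sub>m k 1) (V\<^sup>T * B)"
      unfolding VT AB using V B
      by (subst mult_four_block_mat[of _ 1 1 _ k _ k _ _ 1 _ k]) auto
    also have "\<dots> * ?V = four_block_mat ?e (0\<^sub>m 1 k) (0\<^sub>m k 1) (V\<^sup>T * B * V)"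
      using V B by (subst mult_four_block_mat[of _ 1 1 _ k _ k _ _ 1 _ k]) auto
    also have "\<dots> = diag_of (e # es)"
      unfolding VBV by (rule eq_matI) (auto simp: diag_of_def len nth_Cons')
    finally show ?thesis .
  qed
  have T: "(W * ?V)\<^sup>T = ?V\<^sup>T * W\<^sup>T" by (rule transpose_mult[OF W V'])
  have VT': "?V\<^sup>T \<in> carrier_mat n n" using V' by simp
  show ?case
  proof (intro bexI[of _ "W * ?V"] conjI)
    show "W * ?V \<in> carrier_mat n n" using W V' by simp
    have "(W * ?V)\<^sup>T * (W * ?V) = ?V\<^sup>T * (W\<^sup>T * W) * ?V"
      unfolding T using W WT V' VT' by (simp add: assoc_mult_mat[of _ n n _ n _ n])
    thus "(W * ?V)\<^sup>T * (W * ?V) = 1\<^sub>m n" unfolding WW right_mult_one_mat[OF VT'] VV' .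
    have "(W * ?V)\<^sup>T * M * (W * ?V) = ?V\<^sup>T * (W\<^sup>T * M * W) * ?V"
      unfolding T using W WT V' VT' M by (simp add: assoc_mult_mat[of _ n n _ n _ n])
    thus "(W * ?V)\<^sup>T * M * (W * ?V) = diag_of (e # es)" using VAV by (simp add: A_def)
  qed
qed


section \<open>Pseudoinverse and rank\<close>

lemma minus_mat_eq_0D:
  fixes X :: "'a::group_add mat"
  assumes "X \<in> carrier_mat m n" and "Y \<in> carrier_mat m n" and "X - Y = 0\<^sub>m m n"
  shows "X = Y"
proof (rule eq_matI)
  fix i j assume "i < dim_row Y" "j < dim_col Y"
  hence "i < m" "j < n" using assms by auto
  moreover from this have "(X - Y) $$ (i, j) = 0" unfolding assms(3) by simp
  ultimately show "X $$ (i, j) = Y $$ (i, j)" using assms(1,2) by simp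
qed (use assms in auto)

text \<open>The diagonal entries of \<open>C * C\<^sup>T\<close> are the squared norms of the rows
  of \<open>C\<close>.\<close>

lemma mult_mat_transpose_eq_0:
  fixes C :: "real mat"
  assumes C: "C \<in> carrier_mat nr nc" and CC: "C * C\<^sup>T = 0\<^sub>m nr nr"
  shows "C = 0\<^sub>m nr nc"
proof (rule eq_matI)
  fix i j assume "i < dim_row (0\<^sub>m nr nc)" "j < dim_col (0\<^sub>m nr nc)"
  hence ij: "i < nr" "j < nc" by auto
  have "(\<Sum>k = 0..<nc. (C $$ (i, k))\<^sup>2) = (C * C\<^sup>T) $$ (i, i)"
    using C ij by (simp add: scalar_prod_def power2_eq_square)
  also have "\<dots> = 0" using CC ij by simp
  finally show "C $$ (i, j) = 0\<^sub>m nr nc $$ (i, j)"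
    using ij by (simp add: sum_nonneg_eq_0_iff)
qed (use C in auto)

text \<open>The four conditions inside the definite description of \<open>pinv\<close>, named so
  that existence and uniqueness can be proved apart.\<close>

definition penrose :: "real mat \<Rightarrow> real mat \<Rightarrow> bool" where
  "penrose A X \<longleftrightarrow> X \<in> carrier_mat (dim_col A) (dim_row A) \<and> A * X * A = A \<and> X * A * X = X
      \<and> (A * X)\<^sup>T = A * X \<and> (X * A)\<^sup>T = X * A"

text \<open>Inserting \<open>A = A * Y * A\<close> into \<open>A * X\<close> and transposing
  reverses the order of two symmetric factors, whence \<open>A * X = A * Y\<close>. In the same way
  \<open>X * A = Y * A\<close>, and \<open>X = X * A * X\<close> then turns into
  \<open>Y\<close>.\<close>

lemma penrose_unique:
  assumes X: "penrose A X" and Y: "penrose A Y"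
  shows "X = Y"
proof -
  define m n where "m = dim_row A" and "n = dim_col A"
  have A [simp]: "A \<in> carrier_mat m n" by (simp add: m_def n_def)
  have Xc [simp]: "X \<in> carrier_mat n m" and Yc [simp]: "Y \<in> carrier_mat n m"
    using X Y by (auto simp: penrose_def m_def n_def)
  note [simp] = carrier_matD[OF A] carrier_matD[OF Xc] carrier_matD[OF Yc]
  note x = X[unfolded penrose_def] and y = Y[unfolded penrose_def]
  have "A * X = (A * Y * A) * X" using y by simp
  also have "\<dots> = (A * Y) * (A * X)" by (simp add: mat_mult_assoc_dim)
  finally have "(A * X)\<^sup>T = ((A * Y) * (A * X))\<^sup>T" by simp
  also have "\<dots> = (A * X)\<^sup>T * (A * Y)\<^sup>T" by (rule transpose_mult[of _ m m _ m]) auto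
  also have "\<dots> = (A * X) * (A * Y)" using x y by simp
  also have "\<dots> = (A * X * A) * Y" by (simp add: mat_mult_assoc_dim)
  finally have AX: "A * X = A * Y" using x by simp
  have "X * A = X * (A * Y * A)" using y by simp
  also have "\<dots> = (X * A) * (Y * A)" by (simp add: mat_mult_assoc_dim)
  finally have "(X * A)\<^sup>T = ((X * A) * (Y * A))\<^sup>T" by simp
  also have "\<dots> = (Y * A)\<^sup>T * (X * A)\<^sup>T" by (rule transpose_mult[of _ n n _ n]) auto
  also have "\<dots> = (Y * A) * (X * A)" using x y by simp
  also have "\<dots> = Y * (A * X * A)" by (simp add: mat_mult_assoc_dim)
  finally have XA: "X * A = Y * A" using x by simp
  have "X = X * A * X" using x by simp
  also have "\<dots> = Y * (A * X)" unfolding XA by (simp add: mat_mult_assoc_dim)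
  also have "\<dots> = Y * A * Y" unfolding AX by (simp add: mat_mult_assoc_dim)
  also have "\<dots> = Y" using y by simp
  finally show ?thesis .
qed

lemma diag_of_mult_index:
  fixes B :: "'a::semiring_0 mat"
  assumes "dim_row B = length xs" and "i < length xs" and "j < dim_col B"
  shows "(diag_of xs * B) $$ (i, j) = xs ! i * B $$ (i, j)"
proof -
  have "(diag_of xs * B) $$ (i, j) = (\<Sum>k\<in>{0..<length xs}. (if i = k then xs ! i else 0) * B $$ (k, j))"
    using assms by (simp add: diag_of_def scalar_prod_def)
  also have "\<dots> = (\<Sum>k\<in>{0..<length xs}. if k = i then xs ! i * B $$ (k, j) else 0)"
    by (intro sum.cong) auto
  finally show ?thesis using assms by (simp add: sum.delta)
qed

lemma diag_of_mult_vec_index: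
  fixes v :: "'a::semiring_0 vec"
  assumes "dim_vec v = length xs" and "j < length xs"
  shows "(diag_of xs *\<^sub>v v) $ j = xs ! j * v $ j"
proof -
  have "(diag_of xs *\<^sub>v v) $ j = (\<Sum>k\<in>{0..<length xs}. (if j = k then xs ! j else 0) * v $ k)"
    using assms by (simp add: diag_of_def scalar_prod_def)
  also have "\<dots> = (\<Sum>k\<in>{0..<length xs}. if k = j then xs ! j * v $ k else 0)"
    by (intro sum.cong) auto
  finally show ?thesis using assms by (simp add: sum.delta)
qed

lemma diag_of_mult:
  fixes xs ys :: "'a::semiring_0 list"
  assumes "length xs = length ys"
  shows "diag_of xs * diag_of ys = diag_of (map2 (*) xs ys)"
proof (rule eq_matI)
  fix i j assume "i < dim_row (diag_of (map2 (*) xs ys))" "j < dim_col (diag_of (map2 (*) xs ys))"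
  hence "i < length xs" "j < length ys" using assms by (auto simp: diag_of_def)
  thus "(diag_of xs * diag_of ys) $$ (i, j) = diag_of (map2 (*) xs ys) $$ (i, j)"
    using assms by (subst diag_of_mult_index) (auto simp: diag_of_def)
qed (use assms in \<open>auto simp: diag_of_def\<close>)

lemma transpose_diag_of [simp]: "(diag_of xs)\<^sup>T = diag_of xs"
  by (rule eq_matI) (auto simp: diag_of_def)

lemma gram_symmetric: "(A * A\<^sup>T)\<^sup>T = A * (A :: 'a :: comm_semiring_0 mat)\<^sup>T"
  by (simp add: transpose_mult_dim)

text \<open>The candidate is \<open>A\<^sup>T * G\<close>, where \<open>G\<close> is the
  pseudoinverse of the symmetric matrix \<open>A * A\<^sup>T\<close>, obtained by inverting its
  nonzero eigenvalues.\<close>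

lemma penrose_exists: "\<exists>X. penrose A X"
proof -
  define m n where "m = dim_row A" and "n = dim_col A"
  have A [simp]: "A \<in> carrier_mat m n" by (simp add: m_def n_def)
  have AT [simp]: "A\<^sup>T \<in> carrier_mat n m" by simp
  define M where "M = A * A\<^sup>T"
  have M [simp]: "M \<in> carrier_mat m m" unfolding M_def by (rule mult_carrier_mat[OF A AT])
  note [simp] = carrier_matD[OF A] carrier_matD[OF M] mat_mult_assoc_dim transpose_mult_dim
    one_mult_mat_dim
  have symM: "M\<^sup>T = M" unfolding M_def by (rule gram_symmetric)
  obtain es where es: "char_poly M = (\<Prod>e\<leftarrow>es. [:- e, 1:])" "length es = m"
    using char_poly_symmetric_factorized[OF M symM] by metis
  obtain W where W [simp]: "W \<in> carrier_mat m m" and WW: "W\<^sup>T * W = 1\<^sub>m m"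
    and D: "W\<^sup>T * M * W = diag_of es"
    using spectral_theorem_symmetric[OF M symM es] by auto
  have WT [simp]: "W\<^sup>T \<in> carrier_mat m m" by simp
  note [simp] = carrier_matD[OF W]
  have WW': "W * W\<^sup>T = 1\<^sub>m m" by (rule mat_mult_left_right_inverse[OF WT W WW])
  let ?S = "\<lambda>P. W * P * W\<^sup>T"
  \<comment> \<open>As \<open>inverse 0 = 0\<close>, zero eigenvalues stay zero, which is what a
    pseudoinverse requires.\<close>
  define ies where "ies = map inverse es"
  have Dc [simp]: "diag_of es \<in> carrier_mat m m" "diag_of ies \<in> carrier_mat m m"
    using diag_of_carrier[of es] diag_of_carrier[of ies] es(2) by (auto simp: ies_def)
  have len [simp]: "length es = m" "length ies = m" using es(2) by (simp_all add: ies_def)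
  have S_mult: "?S P * ?S Q = ?S (P * Q)" if "P \<in> carrier_mat m m" "Q \<in> carrier_mat m m" for P Q
  proof -
    have "?S P * ?S Q = W * P * (W\<^sup>T * W) * (Q * W\<^sup>T)"
      using that by (simp add: mat_mult_assoc_dim one_mult_mat_dim)
    thus ?thesis unfolding WW using that by (simp add: mat_mult_assoc_dim one_mult_mat_dim)
  qed
  have "W * (W\<^sup>T * M * W) * W\<^sup>T = (W * W\<^sup>T) * M * (W * W\<^sup>T)"
    by (simp add: mat_mult_assoc_dim one_mult_mat_dim)
  hence MS: "M = ?S (diag_of es)" unfolding D WW' by simp
  define G where "G = ?S (diag_of ies)"
  have G [simp]: "G \<in> carrier_mat m m" by (auto simp: G_def)
  note [simp] = carrier_matD[OF G]
  have dd: "diag_of es * diag_of ies = diag_of ies * diag_of es"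
      "diag_of es * diag_of ies * diag_of es = diag_of es"
      "diag_of ies * diag_of es * diag_of ies = diag_of ies"
  proof -
    have "map2 (*) es ies = map2 (*) ies es" "map2 (*) (map2 (*) es ies) es = es"
        "map2 (*) (map2 (*) ies es) ies = ies"
      by (auto simp: ies_def mult.commute intro!: nth_equalityI) (metis right_inverse)+
    thus "diag_of es * diag_of ies = diag_of ies * diag_of es"
        "diag_of es * diag_of ies * diag_of es = diag_of es"
        "diag_of ies * diag_of es * diag_of ies = diag_of ies"
      by (simp_all add: diag_of_mult del: mat_mult_assoc_dim)
  qed
  note S_mults = S_mult Dc mult_carrier_mat[OF Dc] mult_carrier_mat[OF Dc(2,1)]
  have MG: "M * G = G * M"
    unfolding MS G_def by (simp only: S_mults dd(1))
  have MGM: "M * G * M = M"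
    unfolding MS G_def by (simp only: S_mults dd(2))
  have GMG: "G * M * G = G"
    unfolding MS G_def by (simp only: S_mults dd(3))
  have symG: "G\<^sup>T = G" by (simp add: G_def)
  define X where "X = A\<^sup>T * G"
  have X [simp]: "X \<in> carrier_mat n m" by (auto simp: X_def)
  note [simp] = carrier_matD[OF X]
  have AX: "A * X = M * G" by (simp add: X_def M_def)
  have "penrose A X" unfolding penrose_def
  proof (intro conjI)
    show "X \<in> carrier_mat (dim_col A) (dim_row A)" by simp
    show "(A * X)\<^sup>T = A * X"
      unfolding AX using MG symG symM by simp
    show "(X * A)\<^sup>T = X * A"
      by (simp add: X_def symG)
    show "X * A * X = X"
    proof -
      have "X * A * X = A\<^sup>T * (G * M * G)" by (simp add: X_def M_def)
      thus ?thesis unfolding GMG X_def .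
    qed
    show "A * X * A = A"
    proof -
      \<comment> \<open>The defect \<open>C\<close> satisfies \<open>C * A\<^sup>T = 0\<close>
        because \<open>M * G * M = M\<close>; its transpose has \<open>A\<^sup>T\<close> as a left
        factor, so \<open>C * C\<^sup>T\<close> vanishes too.\<close>
      define C where "C = M * G * A - A"
      have C [simp]: "C \<in> carrier_mat m n" by (simp add: C_def minus_carrier_mat)
      have "C * A\<^sup>T = M * G * A * A\<^sup>T - A * A\<^sup>T"
        unfolding C_def by (rule minus_mult_distrib_mat[of _ m n _ _ m]) auto
      also have "M * G * A * A\<^sup>T = M * G * M" by (simp add: M_def)
      finally have CA: "C * A\<^sup>T = 0\<^sub>m m m" unfolding MGM M_def[symmetric] by (simp add: minus_r_inv_mat[OF M])
      have "C\<^sup>T = A\<^sup>T * (M * G)\<^sup>T - A\<^sup>T"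
        unfolding C_def
        by (subst transpose_minus[of _ m n]) (auto simp: transpose_mult[of _ m m _ n])
      moreover have "A\<^sup>T * (M * G)\<^sup>T \<in> carrier_mat n m" by (rule carrier_matI) simp_all
      ultimately have "C * C\<^sup>T = C * (A\<^sup>T * (M * G)\<^sup>T) - C * A\<^sup>T"
        by (simp only: mult_minus_distrib_mat[OF C _ AT])
      also have "C * (A\<^sup>T * (M * G)\<^sup>T) = (C * A\<^sup>T) * (M * G)\<^sup>T" 
        by (rule assoc_mult_mat[symmetric, of _ m n _ m _ m]) auto
      finally have "C * C\<^sup>T = 0\<^sub>m m m" unfolding CA by simp
      hence "C = 0\<^sub>m m n" by (rule mult_mat_transpose_eq_0[OF C])
      hence "M * G * A = A"
        unfolding C_def by (rule minus_mat_eq_0D[rotated 2]) (auto intro!: carrier_matI)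
      thus ?thesis unfolding AX .
    qed
  qed
  thus ?thesis ..
qed

lemma penrose_pinv: "penrose A (pinv A)"
proof -
  have "pinv A = (THE X. penrose A X)" by (simp add: pinv_def penrose_def)
  thus ?thesis using penrose_exists penrose_unique by (metis theI)
qed

lemma
  assumes A: "A \<in> carrier_mat m n"
  shows pinv_carrier: "pinv A \<in> carrier_mat n m"
    and mult_pinv_mult: "A * (pinv A * A) = A"
    and pinv_mult_symmetric: "(pinv A * A)\<^sup>T = pinv A * A"
proof -
  show X: "pinv A \<in> carrier_mat n m"
    using penrose_pinv[of A] A unfolding penrose_def by simp
  show "A * (pinv A * A) = A"
    using penrose_pinv[of A] assoc_mult_mat[OF A X A] unfolding penrose_def by simp
  show "(pinv A * A)\<^sup>T = pinv A * A"
    using penrose_pinv[of A] unfolding penrose_def by simp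
qed


section \<open>Ordered spectrum of the Gram matrix, and rank\<close>

lemma sq_sv_list_props:
  assumes A: "A \<in> carrier_mat m n"
  shows char_poly_gram_sq_sv_list: "char_poly (A * A\<^sup>T) = (\<Prod>e\<leftarrow>sq_sv_list A. [:- e, 1:])"
    and length_sq_sv_list: "length (sq_sv_list A) = m"
    and sq_sv_list_antimono: "i \<le> j \<Longrightarrow> j < m \<Longrightarrow> sq_sv_list A ! j \<le> sq_sv_list A ! i"
proof -
  have "A * A\<^sup>T \<in> carrier_mat m m" using A by auto
  then obtain es where es: "char_poly (A * A\<^sup>T) = (\<Prod>e\<leftarrow>es. [:- e, 1:])" "length es = m"
    using char_poly_symmetric_factorized gram_symmetric by metis
  \<comment> \<open>The root multiset of a split polynomial is the multiset of its list of roots;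
    hence \<open>sq_sv_list\<close> is a rearrangement of \<open>es\<close>.\<close>
  have "proots (\<Prod>e\<leftarrow>es. [:- e, 1:]) = mset es" for es :: "real list"
  proof (induction es)
    case (Cons e es)
    have "(\<Prod>e\<leftarrow>es. [:- e, 1:]) \<noteq> 0" by (auto simp: prod_list_zero_iff)
    hence "proots ([:- e, 1:] * (\<Prod>e\<leftarrow>es. [:- e, 1:])) = proots [:- e, 1:] + mset es"
      by (subst proots_mult) (simp_all add: Cons)
    thus ?case by (simp del: mult_pCons_left)
  qed simp
  hence mset: "mset (sq_sv_list A) = mset es"
    unfolding sq_sv_list_def es(1) by simp
  have "(\<Prod>e\<leftarrow>xs. [:- e, 1:]) = prod_mset (image_mset (\<lambda>e. [:- e, 1:]) (mset xs))" for xs :: "real list"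
    by (simp flip: prod_mset_prod_list)
  thus "char_poly (A * A\<^sup>T) = (\<Prod>e\<leftarrow>sq_sv_list A. [:- e, 1:])"
    unfolding es(1) by (simp only: mset)
  show len: "length (sq_sv_list A) = m"
    using mset_eq_length[OF mset] es(2) by simp
  show "sq_sv_list A ! j \<le> sq_sv_list A ! i" if "i \<le> j" "j < m"
    using sorted_rev_nth_mono[of "sq_sv_list A" i j] that len
    by (simp add: sq_sv_list_def)
qed

lemma gram_spectral:
  assumes A: "A \<in> carrier_mat m n"
  obtains W where "W \<in> carrier_mat m m" and "W\<^sup>T * W = 1\<^sub>m m" and "W * W\<^sup>T = 1\<^sub>m m"
    and "W\<^sup>T * (A * A\<^sup>T) * W = diag_of (sq_sv_list A)"
proof -
  have M: "A * A\<^sup>T \<in> carrier_mat m m" using A by auto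
  obtain W where W: "W \<in> carrier_mat m m" and WW: "W\<^sup>T * W = 1\<^sub>m m"
    and D: "W\<^sup>T * (A * A\<^sup>T) * W = diag_of (sq_sv_list A)"
    using spectral_theorem_symmetric[OF M gram_symmetric char_poly_gram_sq_sv_list[OF A]
        length_sq_sv_list[OF A]] by auto
  have "W * W\<^sup>T = 1\<^sub>m m" using mat_mult_left_right_inverse[of "W\<^sup>T" m W] W WW by simp
  thus ?thesis using that W WW D by blast
qed

lemma rank_orthonormal_cols:
  fixes B :: "real mat"
  assumes B: "B \<in> carrier_mat m r" and BB: "B\<^sup>T * B = 1\<^sub>m r"
  shows "vec_space.rank m B = r"
proof -
  interpret vec_space "TYPE(real)" m .
  have dist: "distinct (cols B)"
  proof -
    have False if ij: "i < r" "j < r" "i \<noteq> j" "col B i = col B j" for i j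
    proof -
      have "(B\<^sup>T * B) $$ (i, j) = (B\<^sup>T * B) $$ (j, j)" using ij B by simp
      thus False unfolding BB using ij by simp
    qed
    thus ?thesis using B by (auto simp: distinct_conv_nth)
  qed
  have "lin_indpt (set (cols B))"
  proof
    assume "lin_dep (set (cols B))"
    then obtain v where v: "v \<in> carrier_vec r" "v \<noteq> 0\<^sub>v r" "B *\<^sub>v v = 0\<^sub>v m"
      using lin_depE[OF B _ dist] by metis
    have "v = (B\<^sup>T * B) *\<^sub>v v" unfolding BB using v by simp
    also have "\<dots> = B\<^sup>T *\<^sub>v (B *\<^sub>v v)"
      by (rule assoc_mult_mat_vec[of _ r m _ r]) (use B v in auto)
    also have "\<dots> = 0\<^sub>v r" unfolding v(3) using B by (intro eq_vecI) auto
    finally show False using v(2) by simp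
  qed
  thus ?thesis by (rule lin_indpt_full_rank[OF B dist])
qed

text \<open>The right factors express the columns of each matrix by those of the other, so the
  column spaces coincide.\<close>

lemma rank_eq_if_factor_both:
  fixes A B :: "real mat"
  assumes A: "A \<in> carrier_mat m n" and B: "B \<in> carrier_mat m r"
    and C: "C \<in> carrier_mat r n" "A = B * C" and D: "D \<in> carrier_mat n r" "B = A * D"
  shows "vec_space.rank m A = vec_space.rank m B"
proof -
  interpret vec_space "TYPE(real)" m .
  have "col_space A = col_space B"
    unfolding col_space_eq[OF A] col_space_eq[OF B]
  proof (intro subset_antisym subsetI)
    fix y assume "y \<in> {y \<in> carrier_vec (dim_row A). \<exists>x\<in>carrier_vec (dim_col A). A *\<^sub>v x = y}"
    then obtain x where x: "x \<in> carrier_vec n" "A *\<^sub>v x = y" and y: "y \<in> carrier_vec m"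
      using A by auto
    have "y = B *\<^sub>v (C *\<^sub>v x)" using x B C assoc_mult_mat_vec[OF B C(1) x(1)] by simp
    thus "y \<in> {y \<in> carrier_vec (dim_row B). \<exists>x\<in>carrier_vec (dim_col B). B *\<^sub>v x = y}"
      using y B C x by auto
  next
    fix y assume "y \<in> {y \<in> carrier_vec (dim_row B). \<exists>x\<in>carrier_vec (dim_col B). B *\<^sub>v x = y}"
    then obtain x where x: "x \<in> carrier_vec r" "B *\<^sub>v x = y" and y: "y \<in> carrier_vec m"
      using B by auto
    have "y = A *\<^sub>v (D *\<^sub>v x)" using x A D assoc_mult_mat_vec[OF A D(1) x(1)] by simp
    thus "y \<in> {y \<in> carrier_vec (dim_row A). \<exists>x\<in>carrier_vec (dim_col A). A *\<^sub>v x = y}"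
      using y A D x by auto
  qed
  thus ?thesis unfolding rank_def col_space_def by simp
qed

context
  fixes A W :: "real mat" and m n :: nat
  assumes A: "A \<in> carrier_mat m n"
    and W: "W \<in> carrier_mat m m" and WW: "W\<^sup>T * W = 1\<^sub>m m" and WW': "W * W\<^sup>T = 1\<^sub>m m"
    and D: "W\<^sup>T * (A * A\<^sup>T) * W = diag_of (sq_sv_list A)"
  notes [simp] = carrier_matD[OF A] carrier_matD[OF W] length_sq_sv_list[OF A]
begin

lemma gram_eq_diag: "W\<^sup>T * A * (W\<^sup>T * A)\<^sup>T = diag_of (sq_sv_list A)"
  using D by (simp add: mat_mult_assoc_dim transpose_mult_dim)

text \<open>The rows of \<open>W\<^sup>T * A\<close> are orthogonal, and their squared norms form
  the diagonal of their Gram matrix. Hence eigenvalues are nonnegative, and a zero eigenvalue makes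
  a row vanish.\<close>

lemma row_norm_eq_sq_sv:
  assumes "i < m"
  shows "sq_sv_list A ! i = (\<Sum>k = 0..<n. ((W\<^sup>T * A) $$ (i, k))\<^sup>2)"
proof -
  have "sq_sv_list A ! i = diag_of (sq_sv_list A) $$ (i, i)"
    using assms by (simp add: diag_of_def)
  thus ?thesis
    unfolding gram_eq_diag[symmetric] using assms by (simp add: scalar_prod_def power2_eq_square)
qed

lemma sq_sv_list_nonneg: "i < m \<Longrightarrow> sq_sv_list A ! i \<ge> 0"
  by (simp add: row_norm_eq_sq_sv sum_nonneg)

lemma gram_mult_eigenvectors: "A * (A\<^sup>T * W) = W * diag_of (sq_sv_list A)"
proof -
  have "A * (A\<^sup>T * W) = W * W\<^sup>T * (A * A\<^sup>T * W)"
    unfolding WW' by (simp add: one_mult_mat_dim mat_mult_assoc_dim)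
  thus ?thesis unfolding D[symmetric] by (simp add: mat_mult_assoc_dim)
qed

text \<open>The first \<open>r\<close> columns of \<open>W\<close> form \<open>B\<close>, which has
  orthonormal columns. The rows of \<open>W\<^sup>T * A\<close> from \<open>r\<close> on vanish, so
  \<open>A\<close> factors through \<open>B\<close>; the eigenvalues before \<open>r\<close> can be
  divided out, so \<open>B\<close> factors through \<open>A\<close>.\<close>

lemma mrank_eq:
  assumes r: "r \<le> m" and nz: "\<And>i. i < r \<Longrightarrow> sq_sv_list A ! i \<noteq> 0"
    and z: "\<And>i. r \<le> i \<Longrightarrow> i < m \<Longrightarrow> sq_sv_list A ! i = 0"
  shows "mrank A = r"
proof -
  let ?l = "sq_sv_list A"
  define B where "B = mat m r (\<lambda>(i, j). W $$ (i, j))"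
  define C where "C = mat r n (\<lambda>(i, j). (W\<^sup>T * A) $$ (i, j))"
  define Y where "Y = mat n r (\<lambda>(i, j). (A\<^sup>T * W) $$ (i, j) / ?l ! j)"
  have carr: "B \<in> carrier_mat m r" "C \<in> carrier_mat r n" "Y \<in> carrier_mat n r"
    by (auto simp: B_def C_def Y_def)
  have zrow: "(W\<^sup>T * A) $$ (i, j) = 0" if "r \<le> i" "i < m" "j < n" for i j
    using row_norm_eq_sq_sv[OF that(2)] z[OF that(1,2)] that(3)
    by (simp add: sum_nonneg_eq_0_iff)
  have "A = W * (W\<^sup>T * A)"
    using WW' by (simp add: one_mult_mat_dim flip: mat_mult_assoc_dim)
  also have "\<dots> = B * C"
  proof (rule eq_matI)
    fix i j assume "i < dim_row (B * C)" "j < dim_col (B * C)"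
    hence ij: "i < m" "j < n" using carr by auto
    have "(W * (W\<^sup>T * A)) $$ (i, j) = (\<Sum>k=0..<m. W $$ (i, k) * (W\<^sup>T * A) $$ (k, j))"
      using ij by (simp add: scalar_prod_def)
    also have "\<dots> = (\<Sum>k=0..<r. W $$ (i, k) * (W\<^sup>T * A) $$ (k, j))"
      by (rule sum.mono_neutral_right) (use r zrow ij in auto)
    also have "\<dots> = (B * C) $$ (i, j)"
      using ij r by (simp add: scalar_prod_def B_def C_def)
    finally show "(W * (W\<^sup>T * A)) $$ (i, j) = (B * C) $$ (i, j)" .
  qed (use carr in auto)
  finally have ABC: "A = B * C" .
  have BAY: "B = A * Y"
  proof (rule eq_matI)
    fix i j assume "i < dim_row (A * Y)" "j < dim_col (A * Y)"
    hence ij: "i < m" "j < r" using carr by auto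
    have "(A * Y) $$ (i, j) = (A * (A\<^sup>T * W)) $$ (i, j) / ?l ! j"
      using ij r by (simp add: Y_def scalar_prod_def sum_divide_distrib sum_distrib_left)
    also have "A * (A\<^sup>T * W) = (diag_of ?l * W\<^sup>T)\<^sup>T"
      unfolding gram_mult_eigenvectors by (simp add: transpose_mult_dim)
    also have "\<dots> $$ (i, j) = ?l ! j * W $$ (i, j)"
      using ij r diag_of_mult_index[of "W\<^sup>T" ?l j i] by simp
    finally show "B $$ (i, j) = (A * Y) $$ (i, j)"
      using nz[OF ij(2)] ij by (simp add: B_def)
  qed (use carr in auto)
  have BB: "B\<^sup>T * B = 1\<^sub>m r"
  proof (rule eq_matI)
    fix i j assume "i < dim_row (1\<^sub>m r)" "j < dim_col (1\<^sub>m r)"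
    hence ij: "i < r" "j < r" by auto
    hence "(B\<^sup>T * B) $$ (i, j) = (W\<^sup>T * W) $$ (i, j)"
      using r by (simp add: B_def scalar_prod_def)
    thus "(B\<^sup>T * B) $$ (i, j) = 1\<^sub>m r $$ (i, j)" unfolding WW using ij r by simp
  qed (use carr in auto)
  show ?thesis
    unfolding mrank_def
    using rank_eq_if_factor_both[OF A carr(1,2) ABC carr(3) BAY] rank_orthonormal_cols[OF carr(1) BB]
    by simp
qed

end


section \<open>Row submatrices\<close>

lemma pick_initial_segment: "j < n \<Longrightarrow> pick {0..<n} j = j"
proof -
  assume "j < n"
  hence "{a \<in> {0..<n}. a < j} = {0..<j}" by auto
  thus ?thesis using pick_card_in_set[of j "{0..<n}"] \<open>j < n\<close> by simp
qed

context
  fixes T :: "nat set" and m :: nat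
  assumes T: "T \<subseteq> {0..<m}"
begin

private lemma card_T: "card {i. i < m \<and> i \<in> T} = card T"
  using T by (intro arg_cong[of _ _ card]) auto

lemma pick_less: "i < card T \<Longrightarrow> pick T i < m"
  using pick_in_set[of i T] T by auto

lemma row_sub_carrier: "A \<in> carrier_mat m n \<Longrightarrow> row_sub A T \<in> carrier_mat (card T) n"
  using card_T by (auto simp: row_sub_def submatrix_def)

lemma row_sub_index:
  "A \<in> carrier_mat m n \<Longrightarrow> i < card T \<Longrightarrow> j < n \<Longrightarrow> row_sub A T $$ (i, j) = A $$ (pick T i, j)"
  using card_T by (auto simp: row_sub_def submatrix_def pick_initial_segment)

lemma row_row_sub:
  "A \<in> carrier_mat m n \<Longrightarrow> i < card T \<Longrightarrow> row (row_sub A T) i = row A (pick T i)"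
  using row_sub_carrier[of A n] by (intro eq_vecI) (auto simp: row_sub_index pick_less)

lemma row_sub_mult:
  assumes A: "A \<in> carrier_mat m n" and B: "B \<in> carrier_mat n k"
  shows "row_sub (A * B) T = row_sub A T * B"
proof -
  have AB: "A * B \<in> carrier_mat m k" using A B by simp
  show ?thesis
    using row_sub_carrier[OF AB] row_sub_carrier[OF A] A B
    by (intro eq_matI) (auto simp: row_sub_index[OF AB] row_row_sub[OF A] pick_less)
qed

lemma vec_sub_mult_vec:
  assumes A: "A \<in> carrier_mat m n"
  shows "vec_sub (A *\<^sub>v x) T = row_sub A T *\<^sub>v x"
  using row_sub_carrier[OF A] A card_T
  by (intro eq_vecI) (auto simp: vec_sub_def row_row_sub[OF A] pick_less)

lemma row_sub_gram:
  assumes A: "A \<in> carrier_mat m n"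
  shows "row_sub A T * (row_sub A T)\<^sup>T = submatrix (A * A\<^sup>T) T T"
  using row_sub_carrier[OF A] A card_T
  by (intro eq_matI) (auto simp: submatrix_def row_row_sub[OF A] pick_less)

text \<open>No inverse of the Gram matrix \<open>R R\<^sup>T\<close> is needed, so the identity also covers dependent rows:
  the pseudoinverse supplies \<open>z\<close> with \<open>R R\<^sup>T z = R A\<^sup>T y\<close>, hence the update is
  \<open>R R\<^sup>T (I + z v\<^sup>T)\<close> with \<open>v = R A\<^sup>T q\<close>.\<close>
lemma det_rank_one_update_row_sub:
  assumes A: "A \<in> carrier_mat m n" and y: "y \<in> carrier_vec m" and q: "q \<in> carrier_vec m"
  defines "R \<equiv> row_sub A T" and "M \<equiv> A * A\<^sup>T"
  shows "det (R * R\<^sup>T) * ((A\<^sup>T *\<^sub>v q) \<bullet> (pinv R * R *\<^sub>v (A\<^sup>T *\<^sub>v y))) =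
    det (submatrix (M + mat m m (\<lambda>(a, b). (M *\<^sub>v y) $ a * (M *\<^sub>v q) $ b)) T T) - det (R * R\<^sup>T)"
proof -
  let ?s = "card T"
  have R: "R \<in> carrier_mat ?s n" unfolding R_def by (rule row_sub_carrier[OF A])
  have RT: "R\<^sup>T \<in> carrier_mat n ?s" using R by simp
  have AT: "A\<^sup>T \<in> carrier_mat n m" using A by simp
  have X: "R * R\<^sup>T \<in> carrier_mat ?s ?s" using R by auto
  have J: "pinv R \<in> carrier_mat n ?s" by (rule pinv_carrier[OF R])
  have JT: "(pinv R)\<^sup>T \<in> carrier_mat ?s n" using J by simp
  have P: "pinv R * R \<in> carrier_mat n n" using J R by auto
  define d where "d = A\<^sup>T *\<^sub>v y"
  define e where "e = A\<^sup>T *\<^sub>v q"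
  have d: "d \<in> carrier_vec n" and e: "e \<in> carrier_vec n"
    using AT y q by (auto simp: d_def e_def)
  define z where "z = (pinv R)\<^sup>T *\<^sub>v d"
  have z: "z \<in> carrier_vec ?s" using JT d by (auto simp: z_def)
  define v where "v = R *\<^sub>v e"
  have v: "v \<in> carrier_vec ?s" using R e by (auto simp: v_def)
  have "pinv R * R = R\<^sup>T * (pinv R)\<^sup>T"
    using pinv_mult_symmetric[OF R] transpose_mult[OF J R] by simp
  hence Pd: "pinv R * R *\<^sub>v d = R\<^sup>T *\<^sub>v z"
    unfolding z_def using assoc_mult_mat_vec[OF RT JT d] by simp
  have Xz: "(R * R\<^sup>T) *\<^sub>v z = R *\<^sub>v d"
    unfolding assoc_mult_mat_vec[OF R RT z] Pd[symmetric]
      assoc_mult_mat_vec[OF R P d, symmetric] mult_pinv_mult[OF R] ..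
  have "e \<bullet> (R\<^sup>T *\<^sub>v z) = (R\<^sup>T *\<^sub>v z) \<bullet> e"
    by (rule comm_scalar_prod[of _ n]) (use R z e in auto)
  also have "\<dots> = z \<bullet> v"
    unfolding v_def by (rule transpose_vec_mult_scalar[OF R e z])
  also have "\<dots> = v \<bullet> z" by (rule comm_scalar_prod[OF z v])
  finally have ip: "e \<bullet> (pinv R * R *\<^sub>v d) = v \<bullet> z" unfolding Pd .
  let ?K = "mat ?s ?s (\<lambda>(i, j). z $ i * v $ j)"
  have "submatrix (M + mat m m (\<lambda>(a, b). (M *\<^sub>v y) $ a * (M *\<^sub>v q) $ b)) T T = R * R\<^sup>T * (1\<^sub>m ?s + ?K)"
  proof -
    have Me: "M *\<^sub>v y = A *\<^sub>v d" "M *\<^sub>v q = A *\<^sub>v e"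
      unfolding M_def d_def e_def using assoc_mult_mat_vec[OF A AT] y q by auto
    have "R * R\<^sup>T * (1\<^sub>m ?s + ?K) = R * R\<^sup>T + R * R\<^sup>T * ?K"
      using mult_add_distrib_mat[OF X one_carrier_mat, of ?K] right_mult_one_mat[OF X] by simp
    moreover have "(R * R\<^sup>T * ?K) $$ (i, j) = (A *\<^sub>v d) $ pick T i * (A *\<^sub>v e) $ pick T j"
      if ij: "i < ?s" "j < ?s" for i j
    proof -
      have "(X * ?K) $$ (i, j) = (X *\<^sub>v z) $ i * v $ j" if "X \<in> carrier_mat ?s ?s" for X
        using that ij z by (simp add: scalar_prod_def sum_distrib_right mult.assoc)
      hence "(R * R\<^sup>T * ?K) $$ (i, j) = ((R * R\<^sup>T) *\<^sub>v z) $ i * v $ j"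
        using X by blast
      also have "\<dots> = (R *\<^sub>v d) $ i * (R *\<^sub>v e) $ j" unfolding Xz v_def ..
      finally show ?thesis
        using ij R A row_row_sub[OF A] pick_less by (simp add: R_def)
    qed
    moreover have "R * R\<^sup>T = submatrix M T T"
      unfolding R_def M_def by (rule row_sub_gram[OF A])
    ultimately show ?thesis
      unfolding Me using card_T X A by (intro eq_matI) (auto simp: submatrix_def M_def pick_less)
  qed
  hence "det (submatrix (M + mat m m (\<lambda>(a, b). (M *\<^sub>v y) $ a * (M *\<^sub>v q) $ b)) T T) =
      det (R * R\<^sup>T) * (1 + v \<bullet> z)"
    using det_mult[OF X, of "1\<^sub>m ?s + ?K"] det_one_plus_rank_one[OF z v] by simp
  thus ?thesis using ip unfolding d_def e_def by (simp add: algebra_simps)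
qed

end


section \<open>The expected projection under volume sampling\<close>

text \<open>The orthogonal projector onto the row space of the selected rows.\<close>

definition row_proj :: "real mat \<Rightarrow> nat set \<Rightarrow> real mat" where
  "row_proj A T = pinv (row_sub A T) * row_sub A T"

definition mean_proj :: "real mat \<Rightarrow> nat \<Rightarrow> real mat" where
  "mean_proj A s = mat (dim_col A) (dim_col A) (\<lambda>(a, b).
     \<Sum>T\<in>subsets_card (dim_row A) s. vol_prob A s T * row_proj A T $$ (a, b))"

lemma finite_subsets_card [simp]: "finite (subsets_card m s)"
  by (simp add: subsets_card_def)

lemma row_proj_carrier:
  assumes "A \<in> carrier_mat m n" and "T \<subseteq> {0..<m}"
  shows "row_proj A T \<in> carrier_mat n n"
  unfolding row_proj_def
  by (rule mult_carrier_mat[OF pinv_carrier[OF row_sub_carrier[OF assms(2,1)]]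
      row_sub_carrier[OF assms(2,1)]])

lemma mean_proj_carrier: "A \<in> carrier_mat m n \<Longrightarrow> mean_proj A s \<in> carrier_mat n n"
  by (auto simp: mean_proj_def)

lemma mean_proj_mult_vec_index:
  assumes A: "A \<in> carrier_mat m n" and y: "y \<in> carrier_vec n" and a: "a < n"
  shows "(mean_proj A s *\<^sub>v y) $ a =
    (\<Sum>T\<in>subsets_card m s. vol_prob A s T * (row_proj A T *\<^sub>v y) $ a)"
proof -
  have "(mean_proj A s *\<^sub>v y) $ a =
      (\<Sum>b = 0..<n. \<Sum>T\<in>subsets_card m s. vol_prob A s T * (row_proj A T $$ (a, b) * y $ b))"
    using A y a by (simp add: mean_proj_def scalar_prod_def sum_distrib_right mult.assoc)
  also have "\<dots> = (\<Sum>T\<in>subsets_card m s. \<Sum>b = 0..<n. vol_prob A s T * (row_proj A T $$ (a, b) * y $ b))"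
    by (rule sum.swap)
  also have "\<dots> = (\<Sum>T\<in>subsets_card m s. vol_prob A s T * (row_proj A T *\<^sub>v y) $ a)"
  proof (intro sum.cong refl)
    fix T assume "T \<in> subsets_card m s"
    hence "row_proj A T \<in> carrier_mat n n"
      using row_proj_carrier[OF A] by (simp add: subsets_card_def)
    thus "(\<Sum>b = 0..<n. vol_prob A s T * (row_proj A T $$ (a, b) * y $ b)) =
        vol_prob A s T * (row_proj A T *\<^sub>v y) $ a"
      using a y by (simp add: scalar_prod_def sum_distrib_left)
  qed
  finally show ?thesis .
qed

lemma scalar_prod_mean_proj:
  assumes A: "A \<in> carrier_mat m n" and x: "x \<in> carrier_vec n" and y: "y \<in> carrier_vec n"
  shows "x \<bullet> (mean_proj A s *\<^sub>v y) =
    (\<Sum>T\<in>subsets_card m s. vol_prob A s T * (x \<bullet> (row_proj A T *\<^sub>v y)))"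
proof -
  have "x \<bullet> (mean_proj A s *\<^sub>v y) = (\<Sum>a = 0..<n. x $ a * (mean_proj A s *\<^sub>v y) $ a)"
    using mean_proj_carrier[OF A, of s] by (simp add: scalar_prod_def[of x] del: index_mult_mat_vec)
  also have "\<dots> = (\<Sum>a = 0..<n. \<Sum>T\<in>subsets_card m s. vol_prob A s T * (x $ a * (row_proj A T *\<^sub>v y) $ a))"
    using mean_proj_mult_vec_index[OF A y]
    by (intro sum.cong refl) (simp add: sum_distrib_left mult.left_commute)
  also have "\<dots> = (\<Sum>T\<in>subsets_card m s. \<Sum>a = 0..<n. vol_prob A s T * (x $ a * (row_proj A T *\<^sub>v y) $ a))"
    by (rule sum.swap)
  also have "\<dots> = (\<Sum>T\<in>subsets_card m s. vol_prob A s T * (x \<bullet> (row_proj A T *\<^sub>v y)))"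
  proof (intro sum.cong refl)
    fix T assume "T \<in> subsets_card m s"
    hence "row_proj A T \<in> carrier_mat n n"
      using row_proj_carrier[OF A] by (simp add: subsets_card_def)
    thus "(\<Sum>a = 0..<n. vol_prob A s T * (x $ a * (row_proj A T *\<^sub>v y) $ a)) =
        vol_prob A s T * (x \<bullet> (row_proj A T *\<^sub>v y))"
      by (simp add: scalar_prod_def sum_distrib_left)
  qed
  finally show ?thesis .
qed

text \<open>The selected rows are rows of \<open>A\<close>, hence fixed by right multiplication with
  \<open>pinv A * A\<close>; transposing the symmetric projectors moves that factor to the left.
  This keeps the expected error in the range of \<open>A\<^sup>T\<close>.\<close>

lemma pinv_mult_row_proj:
  assumes A: "A \<in> carrier_mat m n" and T: "T \<subseteq> {0..<m}"
  shows "pinv A * A * row_proj A T = row_proj A T"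
proof -
  let ?R = "row_sub A T" and ?Q = "pinv A * A"
  have R: "?R \<in> carrier_mat (card T) n" by (rule row_sub_carrier[OF T A])
  have J: "pinv ?R \<in> carrier_mat n (card T)" by (rule pinv_carrier[OF R])
  have Q: "?Q \<in> carrier_mat n n" using pinv_carrier[OF A] A by auto
  have P: "row_proj A T \<in> carrier_mat n n" by (rule row_proj_carrier[OF A T])
  have symP: "(row_proj A T)\<^sup>T = row_proj A T"
    unfolding row_proj_def by (rule pinv_mult_symmetric[OF R])
  have "row_sub A T * ?Q = row_sub A T"
    unfolding row_sub_mult[OF T A Q, symmetric] mult_pinv_mult[OF A] ..
  hence "row_proj A T * ?Q = row_proj A T"
    unfolding row_proj_def assoc_mult_mat[OF J R Q] by simp
  hence "(row_proj A T * ?Q)\<^sup>T = (row_proj A T)\<^sup>T" by simp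
  thus ?thesis
    unfolding transpose_mult[OF P Q] symP pinv_mult_symmetric[OF A] .
qed

lemma pinv_mult_mean_proj:
  assumes A: "A \<in> carrier_mat m n"
  shows "pinv A * A * mean_proj A s = mean_proj A s"
proof (rule eq_matI)
  let ?Q = "pinv A * A"
  have Q: "?Q \<in> carrier_mat n n" using pinv_carrier[OF A] A by auto
  fix a b assume "a < dim_row (mean_proj A s)" "b < dim_col (mean_proj A s)"
  hence ab: "a < n" "b < n" using A by (auto simp: mean_proj_def)
  have "(?Q * mean_proj A s) $$ (a, b) =
      (\<Sum>c = 0..<n. \<Sum>T\<in>subsets_card m s. vol_prob A s T * (?Q $$ (a, c) * row_proj A T $$ (c, b)))"
  proof -
    have "(Q * mean_proj A s) $$ (a, b) =
      (\<Sum>c = 0..<n. \<Sum>T\<in>subsets_card m s. vol_prob A s T * (Q $$ (a, c) * row_proj A T $$ (c, b)))"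
      if "Q \<in> carrier_mat n n" for Q
      using that A ab by (simp add: mean_proj_def scalar_prod_def sum_distrib_left mult.left_commute)
    thus ?thesis using Q by blast
  qed
  also have "\<dots> = (\<Sum>T\<in>subsets_card m s. \<Sum>c = 0..<n. vol_prob A s T * (?Q $$ (a, c) * row_proj A T $$ (c, b)))"
    by (rule sum.swap)
  also have "\<dots> = (\<Sum>T\<in>subsets_card m s. vol_prob A s T * row_proj A T $$ (a, b))"
  proof (intro sum.cong refl)
    fix T assume "T \<in> subsets_card m s"
    hence T: "T \<subseteq> {0..<m}" by (simp add: subsets_card_def)
    have "(Q * P) $$ (a, b) = (\<Sum>c = 0..<n. Q $$ (a, c) * P $$ (c, b))"
      if "Q \<in> carrier_mat n n" "P \<in> carrier_mat n n" for P Q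
      using that ab by (simp add: scalar_prod_def)
    from this[OF Q row_proj_carrier[OF A T]]
    show "(\<Sum>c = 0..<n. vol_prob A s T * (?Q $$ (a, c) * row_proj A T $$ (c, b))) =
        vol_prob A s T * row_proj A T $$ (a, b)"
      unfolding pinv_mult_row_proj[OF A T] by (simp add: sum_distrib_left)
  qed
  also have "\<dots> = mean_proj A s $$ (a, b)" using ab A by (simp add: mean_proj_def)
  finally show "(?Q * mean_proj A s) $$ (a, b) = mean_proj A s $$ (a, b)" .
qed (use A pinv_carrier[OF A] in \<open>auto simp: mean_proj_def\<close>)

lemma sum_det_submatrix:
  assumes N: "N \<in> carrier_mat m m"
  shows "(\<Sum>T\<in>subsets_card m s. det (submatrix N T T)) = sum_pminors N s"
  unfolding subsets_card_def sum_pminors_def carrier_matD(1)[OF N]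
  by (rule sum.cong[OF refl]) (simp add: det_submatrix_eq_pminor[OF N])

section \<open>Spectrum of the expected projection\<close>

context
  fixes A W :: "real mat" and m n :: nat
  assumes A: "A \<in> carrier_mat m n"
    and W: "W \<in> carrier_mat m m" and WW: "W\<^sup>T * W = 1\<^sub>m m" and WW': "W * W\<^sup>T = 1\<^sub>m m"
    and D: "W\<^sup>T * (A * A\<^sup>T) * W = diag_of (sq_sv_list A)"
  notes [simp] = carrier_matD[OF A] carrier_matD[OF W] length_sq_sv_list[OF A]
begin

private abbreviation "l i \<equiv> sq_sv_list A ! i"

lemma sum_pminors_rotated:
  assumes F: "F \<in> carrier_mat m m" and tri: "upper_triangular F \<or> upper_triangular F\<^sup>T" and s: "s \<le> m"
  shows "sum_pminors (W * F * W\<^sup>T) s = esym (\<lambda>i. F $$ (i, i)) {0..<m} s"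
proof (rule sum_pminors_similar_triangular[OF _ F tri s])
  show "similar_mat (W * F * W\<^sup>T) F"
    unfolding similar_mat_def
    by (intro exI[of _ W] exI[of _ "W\<^sup>T"], rule similar_mat_witI[OF WW' WW refl _ F W])
      (auto intro!: carrier_matI)
qed

lemma gram_eq_rotated: "A * A\<^sup>T = W * diag_of (sq_sv_list A) * W\<^sup>T"
proof -
  have "W * diag_of (sq_sv_list A) * W\<^sup>T = (W * W\<^sup>T) * (A * A\<^sup>T) * (W * W\<^sup>T)"
    unfolding D[symmetric] by (simp add: mat_mult_assoc_dim)
  thus ?thesis unfolding WW' by (simp add: one_mult_mat_dim)
qed

lemma diag_sq_sv_carrier: "diag_of (sq_sv_list A) \<in> carrier_mat m m"
  by (rule carrier_matI) simp_all

lemma sum_pminors_gram: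
  assumes "s \<le> m"
  shows "sum_pminors (A * A\<^sup>T) s = esym l {0..<m} s"
  unfolding gram_eq_rotated
  by (subst sum_pminors_rotated[OF diag_sq_sv_carrier _ assms])
    (auto simp: diag_of_def upper_triangular_def intro!: esym_cong)

lemma gram_mult_col: "j < m \<Longrightarrow> (A * A\<^sup>T) *\<^sub>v col W j = l j \<cdot>\<^sub>v col W j"
proof -
  assume j: "j < m"
  have "(A * A\<^sup>T) *\<^sub>v col W j = col (A * A\<^sup>T * W) j"
    by (rule col_mult2[symmetric, OF _ W j]) (rule carrier_matI, simp_all)
  also have "A * A\<^sup>T * W = (diag_of (sq_sv_list A) * W\<^sup>T)\<^sup>T"
    using gram_mult_eigenvectors[OF A W WW WW' D] by (simp add: mat_mult_assoc_dim transpose_mult_dim)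
  also have "col \<dots> j = l j \<cdot>\<^sub>v col W j"
    using j diag_of_mult_index[of "W\<^sup>T" "sq_sv_list A" j] by (intro eq_vecI) auto
  finally show ?thesis .
qed

text \<open>In the basis \<open>W\<close> the update is a single entry at position
  \<open>(j, i)\<close>, so the updated matrix is triangular and only its diagonal counts. For
  \<open>i = j\<close> the value \<open>l i\<close> becomes \<open>l i + (l i)\<^sup>2\<close>;
  otherwise the diagonal is unchanged.\<close>

lemma sum_pminors_rank_one_update:
  assumes i: "i < m" and j: "j < m" and s: "1 \<le> s" "s \<le> m"
  defines "M \<equiv> A * A\<^sup>T"
  shows "sum_pminors (M + mat m m (\<lambda>(a, b). (M *\<^sub>v col W j) $ a * (M *\<^sub>v col W i) $ b)) s
      - sum_pminors M s = (if i = j then (l i)\<^sup>2 * esym l ({0..<m} - {i}) (s - 1) else 0)"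
proof -
  let ?D = "diag_of (sq_sv_list A)"
  define E where "E = mat m m (\<lambda>(a, b). if a = j \<and> b = i then l j * l i else 0)"
  have E: "E \<in> carrier_mat m m" by (simp add: E_def)
  have EW: "(E * W\<^sup>T) $$ (c, b) = (if c = j then l j * l i * W $$ (b, i) else 0)"
    if "c < m" "b < m" for c b
  proof -
    have "(E * W\<^sup>T) $$ (c, b) = (\<Sum>k\<in>{0..<m}. (if c = j \<and> k = i then l j * l i else 0) * W $$ (b, k))"
      using that by (simp add: E_def scalar_prod_def)
    also have "\<dots> = (\<Sum>k\<in>{0..<m}. if k = i then (if c = j then l j * l i * W $$ (b, k) else 0) else 0)"
      by (intro sum.cong) auto
    finally have "(E * W\<^sup>T) $$ (c, b) = \<dots>" .
    thus ?thesis using i by (simp add: sum.delta)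
  qed
  have WEW: "mat m m (\<lambda>(a, b). (M *\<^sub>v col W j) $ a * (M *\<^sub>v col W i) $ b) = W * (E * W\<^sup>T)"
  proof (rule eq_matI)
    fix a b assume "a < dim_row (W * (E * W\<^sup>T))" "b < dim_col (W * (E * W\<^sup>T))"
    hence ab: "a < m" "b < m" by auto
    have "(W * (E * W\<^sup>T)) $$ (a, b) = (\<Sum>c\<in>{0..<m}. W $$ (a, c) * (E * W\<^sup>T) $$ (c, b))"
      using ab E by (simp add: scalar_prod_def)
    also have "\<dots> = (\<Sum>c\<in>{0..<m}. if c = j then W $$ (a, c) * (l j * l i * W $$ (b, i)) else 0)"
      using ab EW by (intro sum.cong) auto
    also have "\<dots> = l j * W $$ (a, j) * (l i * W $$ (b, i))"
      using j by (simp add: sum.delta)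
    finally show "mat m m (\<lambda>(a, b). (M *\<^sub>v col W j) $ a * (M *\<^sub>v col W i) $ b) $$ (a, b) =
        (W * (E * W\<^sup>T)) $$ (a, b)"
      using ab i j unfolding M_def gram_mult_col[OF i] gram_mult_col[OF j] by simp
  qed auto
  have "M + W * (E * W\<^sup>T) = W * (?D + E) * W\<^sup>T"
  proof -
    have "W * (?D + E) * W\<^sup>T = (W * ?D + W * E) * W\<^sup>T"
      by (subst mult_add_distrib_mat[OF W diag_sq_sv_carrier E]) simp
    also have "\<dots> = W * ?D * W\<^sup>T + W * E * W\<^sup>T"
      by (rule add_mult_distrib_mat[of _ m m _ _ m]) (use W E diag_sq_sv_carrier in auto)
    finally show ?thesis
      unfolding M_def gram_eq_rotated using E by (simp add: mat_mult_assoc_dim)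
  qed
  moreover have "sum_pminors (W * (?D + E) * W\<^sup>T) s = esym (\<lambda>a. (?D + E) $$ (a, a)) {0..<m} s"
  proof (rule sum_pminors_rotated[OF _ _ s(2)])
    show "?D + E \<in> carrier_mat m m" using E diag_sq_sv_carrier by simp
    show "upper_triangular (?D + E) \<or> upper_triangular (?D + E)\<^sup>T"
      \<comment> \<open>The extra entry lies on or above the diagonal, or strictly below it.\<close>
      by (cases "j \<le> i") (auto simp: upper_triangular_def diag_of_def E_def)
  qed
  moreover have "esym (\<lambda>a. (?D + E) $$ (a, a)) {0..<m} s =
      (if i = j then esym (l(i := l i + (l i)\<^sup>2)) {0..<m} s else esym l {0..<m} s)"
    by (auto simp: diag_of_def E_def power2_eq_square intro!: esym_cong)
  ultimately show ?thesis
    unfolding WEW using sum_pminors_gram[OF s(2), folded M_def]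
      esym_fun_upd[of "{0..<m}" i s l "l i + (l i)\<^sup>2"] i s by (cases "i = j") simp_all
qed

text \<open>Gram matrices of selected rows are principal submatrices of
  \<open>A * A\<^sup>T\<close>, so the normalising constant of volume sampling is a sum of principal
  minors.\<close>

lemma sum_vol_prob_dets:
  assumes "s \<le> m"
  shows "(\<Sum>J\<in>subsets_card m s. det (row_sub A J * (row_sub A J)\<^sup>T)) = esym l {0..<m} s"
proof -
  have "(\<Sum>J\<in>subsets_card m s. det (row_sub A J * (row_sub A J)\<^sup>T)) =
      (\<Sum>J\<in>subsets_card m s. det (submatrix (A * A\<^sup>T) J J))"
    by (intro sum.cong refl) (simp add: subsets_card_def row_sub_gram[OF _ A])
  also have "\<dots> = sum_pminors (A * A\<^sup>T) s"
    by (rule sum_det_submatrix) (use A in auto)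
  finally show ?thesis using sum_pminors_gram[OF assms] by simp
qed

text \<open>The sampling weight is the very determinant that multiplies the bilinear form in
  \<open>det_rank_one_update_row_sub\<close>. Each summand is therefore a normalised difference of
  principal minors, and summing over \<open>T\<close> leaves the change of
  \<open>sum_pminors\<close> under a rank-one update.\<close>

lemma mean_proj_diagonal:
  assumes i: "i < m" and j: "j < m" and s: "1 \<le> s" "s \<le> m"
  shows "(A\<^sup>T *\<^sub>v col W i) \<bullet> (mean_proj A s *\<^sub>v (A\<^sup>T *\<^sub>v col W j)) =
    (if i = j then (l i)\<^sup>2 * esym l ({0..<m} - {i}) (s - 1) / esym l {0..<m} s else 0)"
proof -
  let ?x = "A\<^sup>T *\<^sub>v col W i" and ?y = "A\<^sup>T *\<^sub>v col W j" and ?M = "A * A\<^sup>T"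
  let ?N = "?M + mat m m (\<lambda>(a, b). (?M *\<^sub>v col W j) $ a * (?M *\<^sub>v col W i) $ b)"
  let ?Z = "esym l {0..<m} s"
  have cols: "col W i \<in> carrier_vec m" "col W j \<in> carrier_vec m"
    by (rule carrier_vecI, simp)+
  have AT: "A\<^sup>T \<in> carrier_mat n m" by (rule carrier_matI) simp_all
  have xy: "?x \<in> carrier_vec n" "?y \<in> carrier_vec n"
    by (rule mult_mat_vec_carrier[OF AT cols(1)] mult_mat_vec_carrier[OF AT cols(2)])+
  have M: "?M \<in> carrier_mat m m" by (rule carrier_matI) simp_all
  have N: "?N \<in> carrier_mat m m" by (rule carrier_matI) simp_all
  have "?x \<bullet> (mean_proj A s *\<^sub>v ?y) =
      (\<Sum>T\<in>subsets_card m s. (det (submatrix ?N T T) - det (submatrix ?M T T)) / ?Z)"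
    unfolding scalar_prod_mean_proj[OF A xy]
  proof (rule sum.cong[OF refl])
    fix T assume "T \<in> subsets_card m s"
    hence T: "T \<subseteq> {0..<m}" by (simp add: subsets_card_def)
    show "vol_prob A s T * (?x \<bullet> (row_proj A T *\<^sub>v ?y)) = (det (submatrix ?N T T) - det (submatrix ?M T T)) / ?Z"
      using det_rank_one_update_row_sub[OF T A cols(2,1)]
      unfolding vol_prob_def row_proj_def carrier_matD[OF A] sum_vol_prob_dets[OF s(2)] row_sub_gram[OF T A]
      by (simp add: field_simps)
  qed
  also have "\<dots> = (sum_pminors ?N s - sum_pminors ?M s) / ?Z"
    unfolding sum_divide_distrib[symmetric] sum_subtractf sum_det_submatrix[OF N] sum_det_submatrix[OF M] ..
  finally show ?thesis
    unfolding sum_pminors_rank_one_update[OF i j s] by simp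
qed

text \<open>With \<open>C = W\<^sup>T * A\<close> and \<open>d = C\<^sup>T *\<^sub>v t\<close>, both
  \<open>C * (H * C\<^sup>T)\<close> and \<open>C * C\<^sup>T\<close> are diagonal, with entries
  \<open>\<kappa> j\<close> and \<open>l j\<close>, and \<open>\<kappa> j\<close> is
  \<open>l j\<close> times the claimed eigenvalue. No division by \<open>l j\<close> occurs, so zero
  eigenvalues are covered.\<close>

lemma mean_proj_eigen_coordinate:
  assumes d: "d \<in> carrier_vec n" and range: "(pinv A * A) *\<^sub>v d = d" and j: "j < m"
    and s: "1 \<le> s" "s \<le> m"
  shows "(W\<^sup>T * A *\<^sub>v (mean_proj A s *\<^sub>v d)) $ j =
    l j * esym l ({0..<m} - {j}) (s - 1) / esym l {0..<m} s * (W\<^sup>T * A *\<^sub>v d) $ j"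
proof -
  define C where "C = W\<^sup>T * A"
  define H where "H = mean_proj A s"
  define \<kappa> where "\<kappa> i = (l i)\<^sup>2 * esym l ({0..<m} - {i}) (s - 1) / esym l {0..<m} s" for i
  have C: "C \<in> carrier_mat m n" unfolding C_def by (rule carrier_matI) simp_all
  have CT: "C\<^sup>T \<in> carrier_mat n m" using C by simp
  have H: "H \<in> carrier_mat n n" unfolding H_def by (rule mean_proj_carrier[OF A])
  have J: "pinv A \<in> carrier_mat n m" by (rule pinv_carrier[OF A])
  have rowC: "row C i = A\<^sup>T *\<^sub>v col W i" if "i < m" for i
    using that A W unfolding C_def by (intro eq_vecI) (auto intro!: comm_scalar_prod[of _ m])
  have CHC: "C * (H * C\<^sup>T) = diag_of (map \<kappa> [0..<m])"
  proof (rule eq_matI)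
    fix i k assume "i < dim_row (diag_of (map \<kappa> [0..<m]))" "k < dim_col (diag_of (map \<kappa> [0..<m]))"
    hence ik: "i < m" "k < m" by (auto simp: diag_of_def)
    have "(C * (H * C\<^sup>T)) $$ (i, k) = row C i \<bullet> col (H * C\<^sup>T) k"
      using ik C H by simp
    also have "col (H * C\<^sup>T) k = H *\<^sub>v row C k"
      using col_mult2[OF H CT ik(2)] ik C by simp
    also have "row C i \<bullet> (H *\<^sub>v row C k) = (if i = k then \<kappa> i else 0)"
      unfolding rowC[OF ik(1)] rowC[OF ik(2)] H_def \<kappa>_def
      by (rule mean_proj_diagonal[OF ik s])
    finally show "(C * (H * C\<^sup>T)) $$ (i, k) = diag_of (map \<kappa> [0..<m]) $$ (i, k)"
      using ik by (simp add: diag_of_def)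
  qed (use C H in \<open>auto simp: diag_of_def\<close>)
  have CC: "C * C\<^sup>T = diag_of (sq_sv_list A)"
    unfolding C_def by (rule gram_eq_diag[OF A W WW WW' D])
  \<comment> \<open>Transposing the symmetric projector gives
    \<open>pinv A * A = A\<^sup>T * (pinv A)\<^sup>T\<close>, so this \<open>t\<close> represents
    \<open>d\<close>.\<close>
  define t where "t = (W\<^sup>T * (pinv A)\<^sup>T) *\<^sub>v d"
  have WJ: "W\<^sup>T * (pinv A)\<^sup>T \<in> carrier_mat m n" using W J by auto
  have t: "t \<in> carrier_vec m" unfolding t_def using WJ d by auto
  have "C\<^sup>T * (W\<^sup>T * (pinv A)\<^sup>T) = A\<^sup>T * (W * W\<^sup>T) * (pinv A)\<^sup>T"
    unfolding C_def using J by (simp add: mat_mult_assoc_dim transpose_mult_dim)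
  also have "\<dots> = (pinv A * A)\<^sup>T"
    unfolding WW' using J by (simp add: one_mult_mat_dim transpose_mult_dim)
  also have "\<dots> = pinv A * A" by (rule pinv_mult_symmetric[OF A])
  finally have d_eq: "C\<^sup>T *\<^sub>v t = d"
    unfolding t_def assoc_mult_mat_vec[OF CT WJ d, symmetric] using range by simp
  have "(C *\<^sub>v (H *\<^sub>v d)) = (C * (H * C\<^sup>T)) *\<^sub>v t"
    unfolding d_eq[symmetric]
    using assoc_mult_mat_vec[OF H CT t] assoc_mult_mat_vec[OF C mult_carrier_mat[OF H CT] t] by simp
  hence "(C *\<^sub>v (H *\<^sub>v d)) $ j = \<kappa> j * t $ j"
    unfolding CHC using t j by (simp add: diag_of_mult_vec_index del: index_mult_mat_vec)
  moreover have "C *\<^sub>v d = diag_of (sq_sv_list A) *\<^sub>v t"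
    unfolding d_eq[symmetric] CC[symmetric] by (rule assoc_mult_mat_vec[symmetric, OF C CT t])
  hence "(C *\<^sub>v d) $ j = l j * t $ j"
    using t j by (simp add: diag_of_mult_vec_index del: index_mult_mat_vec)
  ultimately show ?thesis
    unfolding C_def H_def \<kappa>_def by (simp add: power2_eq_square)
qed

end


section \<open>The expected iterates\<close>

text \<open>Tower property: a realisation of the draws up to \<open>k\<close> consists of the
  earlier draws and the last value \<open>T\<close>, and the weights multiply.\<close>

lemma sum_PiE_Suc:
  fixes f :: "(nat \<Rightarrow> 'b) \<Rightarrow> real"
  assumes "finite \<Omega>" and k: "k \<ge> 1"
  shows "(\<Sum>S\<in>PiE {1..<Suc k} (\<lambda>_. \<Omega>). (\<Prod>j\<in>{1..<Suc k}. p (S j)) * f S) =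
    (\<Sum>S\<in>PiE {1..<k} (\<lambda>_. \<Omega>). (\<Prod>j\<in>{1..<k}. p (S j)) * (\<Sum>T\<in>\<Omega>. p T * f (S(k := T))))"
proof -
  have ins: "{1..<Suc k} = insert k {1..<k}" using k by auto
  have "(\<Sum>S\<in>PiE {1..<Suc k} (\<lambda>_. \<Omega>). (\<Prod>j\<in>{1..<Suc k}. p (S j)) * f S) =
      (\<Sum>(T, S)\<in>\<Omega> \<times> PiE {1..<k} (\<lambda>_. \<Omega>). (\<Prod>j\<in>{1..<Suc k}. p ((S(k := T)) j)) * f (S(k := T)))"
    unfolding ins PiE_insert_eq
    by (subst sum.reindex[OF inj_combinator]) (auto simp: case_prod_beta o_def)
  also have "\<dots> = (\<Sum>(T, S)\<in>\<Omega> \<times> PiE {1..<k} (\<lambda>_. \<Omega>). (\<Prod>j\<in>{1..<k}. p (S j)) * (p T * f (S(k := T))))"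
  proof (intro sum.cong refl, clarify)
    fix T S
    have "(\<Prod>j\<in>{1..<Suc k}. p ((S(k := T)) j)) = p T * (\<Prod>j\<in>{1..<k}. p ((S(k := T)) j))"
      unfolding ins by (subst prod.insert) auto
    also have "(\<Prod>j\<in>{1..<k}. p ((S(k := T)) j)) = (\<Prod>j\<in>{1..<k}. p (S j))"
      by (intro prod.cong) auto
    finally show "(\<Prod>j\<in>{1..<Suc k}. p ((S(k := T)) j)) * f (S(k := T)) =
        (\<Prod>j\<in>{1..<k}. p (S j)) * (p T * f (S(k := T)))"
      by simp
  qed
  also have "\<dots> = (\<Sum>S\<in>PiE {1..<k} (\<lambda>_. \<Omega>). \<Sum>T\<in>\<Omega>. (\<Prod>j\<in>{1..<k}. p (S j)) * (p T * f (S(k := T))))"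
    unfolding sum.cartesian_product[symmetric] by (rule sum.swap)
  finally show ?thesis by (simp add: sum_distrib_left)
qed

text \<open>Serves as independence of the past: overwriting draw \<open>Suc k\<close> leaves the
  iterates up to \<open>Suc k\<close> unchanged.\<close>

lemma iter_x_cong:
  assumes "\<And>j. 1 \<le> j \<Longrightarrow> j < k \<Longrightarrow> S j = S' j"
  shows "iter_x A b \<omega> \<beta> x0 S k = iter_x A b \<omega> \<beta> x0 S' k"
  using assms
proof (induction k rule: less_induct)
  case (less k)
  consider "k = 0" | "k = 1" | k' where "k = Suc (Suc k')"
    by (metis One_nat_def not0_implies_Suc)
  thus ?case
  proof cases
    case 3
    thus ?thesis using less.IH[of "Suc k'"] less.IH[of k'] less.prems by (simp add: Let_def)
  qed auto
qed

lemma exp_iter_carrier: "A \<in> carrier_mat m n \<Longrightarrow> exp_iter A b s \<omega> \<beta> x0 k \<in> carrier_vec n"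
  by (auto simp: exp_iter_def)

lemma exp_iter_0_1:
  assumes "A \<in> carrier_mat m n" and "x0 \<in> carrier_vec n"
  shows "exp_iter A b s \<omega> \<beta> x0 0 = x0" and "exp_iter A b s \<omega> \<beta> x0 (Suc 0) = x0"
  using assms by (auto simp: exp_iter_def intro!: eq_vecI)

context
  fixes A :: "real mat" and b x0 xs :: "real vec" and m n s :: nat and \<omega> \<beta> :: real
  assumes A: "A \<in> carrier_mat m n" and x0: "x0 \<in> carrier_vec n"
    and xs: "xs \<in> carrier_vec n" and sol: "A *\<^sub>v xs = b"
begin

private abbreviation "X \<equiv> iter_x A b \<omega> \<beta> x0"
private abbreviation "\<Omega> \<equiv> subsets_card m s"

text \<open>As \<open>xs\<close> solves the system, the selected part of \<open>b\<close> is the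
  selected rows applied to \<open>xs\<close>. Residuals thus turn into errors, and the pseudoinverse
  step into a projection of the error.\<close>

lemma iter_x_step:
  assumes T: "S (Suc k) \<subseteq> {0..<m}"
    and carr: "X S (Suc k) \<in> carrier_vec n" "X S k \<in> carrier_vec n"
  shows "X S (Suc (Suc k)) = X S (Suc k) - \<omega> \<cdot>\<^sub>v (row_proj A (S (Suc k)) *\<^sub>v (X S (Suc k) - xs))
      + \<beta> \<cdot>\<^sub>v (X S (Suc k) - X S k)"
proof -
  let ?R = "row_sub A (S (Suc k))"
  have R: "?R \<in> carrier_mat (card (S (Suc k))) n" by (rule row_sub_carrier[OF T A])
  have e: "X S (Suc k) - xs \<in> carrier_vec n" using carr xs by simp
  have vs: "vec_sub b (S (Suc k)) = ?R *\<^sub>v xs"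
    using vec_sub_mult_vec[OF T A, of xs] sol by simp
  have "?R *\<^sub>v X S (Suc k) - vec_sub b (S (Suc k)) = ?R *\<^sub>v (X S (Suc k) - xs)"
    unfolding vs
    by (rule mult_minus_distrib_mat_vec[symmetric, OF R carr(1) xs])
  moreover have "pinv ?R *\<^sub>v (?R *\<^sub>v (X S (Suc k) - xs)) = row_proj A (S (Suc k)) *\<^sub>v (X S (Suc k) - xs)"
    unfolding row_proj_def by (rule assoc_mult_mat_vec[symmetric, OF pinv_carrier[OF R] R e])
  ultimately show ?thesis by (simp add: Let_def)
qed

lemma iter_x_carrier:
  assumes "\<And>j. 1 \<le> j \<Longrightarrow> j < k \<Longrightarrow> S j \<subseteq> {0..<m}"
  shows "X S k \<in> carrier_vec n"
  using assms
proof (induction k rule: less_induct)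
  case (less k)
  consider "k = 0" | "k = 1" | k' where "k = Suc (Suc k')"
    by (metis One_nat_def not0_implies_Suc)
  thus ?case
  proof cases
    case 3
    have T: "S (Suc k') \<subseteq> {0..<m}" using less.prems 3 by simp
    have c: "X S (Suc k') \<in> carrier_vec n" "X S k' \<in> carrier_vec n"
      using less 3 by simp_all
    show ?thesis
      unfolding 3 iter_x_step[OF T c] using c row_proj_carrier[OF A T] xs
      by (simp add: mult_mat_vec_carrier[of _ n n])
  qed (use x0 in auto)
qed

section \<open>Averaging over the draws\<close>

context
  assumes prob: "(\<Sum>T\<in>\<Omega>. vol_prob A s T) = 1"
begin

text \<open>Expectation over the draws of index 1 to \<open>k - 1\<close>, those on which the
  iterate of index \<open>k\<close> depends.\<close>

private definition E :: "nat \<Rightarrow> ((nat \<Rightarrow> nat set) \<Rightarrow> real) \<Rightarrow> real" where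
  "E k f = (\<Sum>S\<in>PiE {1..<k} (\<lambda>_. \<Omega>). (\<Prod>j\<in>{1..<k}. vol_prob A s (S j)) * f S)"

private lemma E_Suc: "k \<ge> 1 \<Longrightarrow> E (Suc k) f = E k (\<lambda>S. \<Sum>T\<in>\<Omega>. vol_prob A s T * f (S(k := T)))"
  unfolding E_def by (rule sum_PiE_Suc) auto

private lemma E_cong: "(\<And>S. S \<in> PiE {1..<k} (\<lambda>_. \<Omega>) \<Longrightarrow> f S = g S) \<Longrightarrow> E k f = E k g"
  unfolding E_def by (intro sum.cong) auto

private lemma E_linear:
  "E k (\<lambda>S. f S + g S) = E k f + E k g" "E k (\<lambda>S. f S - g S) = E k f - E k g"
  "E k (\<lambda>S. c * f S) = c * E k f"
  by (simp_all add: E_def sum.distrib sum_subtractf sum_distrib_left algebra_simps)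

private lemma E_sum: "E k (\<lambda>S. \<Sum>i\<in>I. h i S) = (\<Sum>i\<in>I. E k (h i))"
  unfolding E_def by (simp add: sum_distrib_left sum.swap[of _ I])

text \<open>The weights of the extra draw sum to 1. For \<open>k = 0\<close> no draw is added, since
  indices start at 1.\<close>

private lemma E_Suc_indep:
  assumes "\<And>S T. f (S(k := T)) = f S"
  shows "E (Suc k) f = E k f"
proof (cases "k = 0")
  case False
  hence "E (Suc k) f = E k (\<lambda>S. (\<Sum>T\<in>\<Omega>. vol_prob A s T) * f S)"
    by (simp add: E_Suc assms sum_distrib_right)
  thus ?thesis by (simp add: prob)
qed (simp add: E_def)

private lemma E_const: "E k (\<lambda>S. c) = c"
proof (induction k)
  case (Suc k)
  thus ?case using E_Suc_indep[of "\<lambda>_. c" k] by simp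
qed (simp add: E_def)

private lemma error_index:
  "i < n \<Longrightarrow> (exp_iter A b s \<omega> \<beta> x0 k - xs) $ i = E k (\<lambda>S. X S k $ i - xs $ i)"
  using A xs by (simp add: E_linear E_const) (simp add: exp_iter_def E_def)

text \<open>Given the earlier draws, the step is affine in the projector of the fresh draw
  \<open>T\<close>, so averaging over \<open>T\<close> replaces that projector by
  \<open>mean_proj\<close>. The expectation over the earlier draws then passes through by
  linearity.\<close>

lemma exp_iter_error_rec:
  defines "d \<equiv> \<lambda>k. exp_iter A b s \<omega> \<beta> x0 k - xs"
  shows "d (Suc (Suc k)) = d (Suc k) - \<omega> \<cdot>\<^sub>v (mean_proj A s *\<^sub>v d (Suc k)) + \<beta> \<cdot>\<^sub>v (d (Suc k) - d k)"
proof (rule eq_vecI)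
  have d: "d k \<in> carrier_vec n" for k
    using exp_iter_carrier[OF A] xs by (simp add: d_def)
  have H: "mean_proj A s \<in> carrier_mat n n" by (rule mean_proj_carrier[OF A])
  show "dim_vec (d (Suc (Suc k))) =
      dim_vec (d (Suc k) - \<omega> \<cdot>\<^sub>v (mean_proj A s *\<^sub>v d (Suc k)) + \<beta> \<cdot>\<^sub>v (d (Suc k) - d k))"
    using d[THEN carrier_vecD] by simp
  fix i assume "i < dim_vec (d (Suc k) - \<omega> \<cdot>\<^sub>v (mean_proj A s *\<^sub>v d (Suc k)) + \<beta> \<cdot>\<^sub>v (d (Suc k) - d k))"
  hence i: "i < n" using d[THEN carrier_vecD] by simp
  let ?e = "\<lambda>k S. X S k - xs"
  have sub: "S j \<subseteq> {0..<m}" if "S \<in> PiE {1..<k} (\<lambda>_. \<Omega>)" "1 \<le> j" "j < k" for S j k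
    using that by (auto simp: subsets_card_def PiE_iff)
  have "d (Suc (Suc k)) $ i =
      E (Suc k) (\<lambda>S. \<Sum>T\<in>\<Omega>. vol_prob A s T * (X (S(Suc k := T)) (Suc (Suc k)) $ i - xs $ i))"
    unfolding d_def error_index[OF i] by (rule E_Suc) simp
  also have "\<dots> = E (Suc k) (\<lambda>S. (X S (Suc k) $ i - xs $ i)
      - \<omega> * (\<Sum>l = 0..<n. mean_proj A s $$ (i, l) * (X S (Suc k) $ l - xs $ l))
      + \<beta> * ((X S (Suc k) $ i - xs $ i) - (X S k $ i - xs $ i)))"
  proof (rule E_cong)
    fix S assume S: "S \<in> PiE {1..<Suc k} (\<lambda>_. \<Omega>)"
    have c: "X S (Suc k) \<in> carrier_vec n" "X S k \<in> carrier_vec n"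
      by (rule iter_x_carrier, use sub[OF S] in auto)+
    have e: "?e (Suc k) S \<in> carrier_vec n" using c xs by simp
    have step: "X (S(Suc k := T)) (Suc (Suc k)) $ i - xs $ i =
        (X S (Suc k) $ i - xs $ i) - \<omega> * (row_proj A T *\<^sub>v ?e (Suc k) S) $ i
        + \<beta> * (X S (Suc k) $ i - X S k $ i)" if "T \<in> \<Omega>" for T
    proof -
      have T: "T \<subseteq> {0..<m}" using that by (simp add: subsets_card_def)
      have eq: "X (S(Suc k := T)) (Suc k) = X S (Suc k)" "X (S(Suc k := T)) k = X S k"
        by (rule iter_x_cong; simp)+
      have "X (S(Suc k := T)) (Suc (Suc k)) =
          X S (Suc k) - \<omega> \<cdot>\<^sub>v (row_proj A T *\<^sub>v ?e (Suc k) S) + \<beta> \<cdot>\<^sub>v (X S (Suc k) - X S k)"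
        using iter_x_step[of "S(Suc k := T)" k] T c unfolding eq by simp
      thus ?thesis using i c xs row_proj_carrier[OF A T] by simp
    qed
    have "(\<Sum>T\<in>\<Omega>. vol_prob A s T * (X (S(Suc k := T)) (Suc (Suc k)) $ i - xs $ i)) =
        (\<Sum>T\<in>\<Omega>. vol_prob A s T * ((X S (Suc k) $ i - xs $ i) + \<beta> * (X S (Suc k) $ i - X S k $ i))
          - \<omega> * (vol_prob A s T * (row_proj A T *\<^sub>v ?e (Suc k) S) $ i))"
      by (intro sum.cong refl) (simp only: step, simp add: algebra_simps)
    also have "\<dots> = (X S (Suc k) $ i - xs $ i) + \<beta> * (X S (Suc k) $ i - X S k $ i)
        - \<omega> * (mean_proj A s *\<^sub>v ?e (Suc k) S) $ i"
      unfolding sum_subtractf sum_distrib_right[symmetric] sum_distrib_left[symmetric] prob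
        mean_proj_mult_vec_index[OF A e i] by simp
    also have "(mean_proj A s *\<^sub>v ?e (Suc k) S) $ i =
        (\<Sum>l = 0..<n. mean_proj A s $$ (i, l) * (X S (Suc k) $ l - xs $ l))"
      using H i c xs by (simp add: scalar_prod_def)
    finally have eq: "(\<Sum>T\<in>\<Omega>. vol_prob A s T * (X (S(Suc k := T)) (Suc (Suc k)) $ i - xs $ i)) =
        (X S (Suc k) $ i - xs $ i) + \<beta> * (X S (Suc k) $ i - X S k $ i)
        - \<omega> * (\<Sum>l = 0..<n. mean_proj A s $$ (i, l) * (X S (Suc k) $ l - xs $ l))" .
    show "(\<Sum>T\<in>\<Omega>. vol_prob A s T * (X (S(Suc k := T)) (Suc (Suc k)) $ i - xs $ i)) =
        (X S (Suc k) $ i - xs $ i)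
        - \<omega> * (\<Sum>l = 0..<n. mean_proj A s $$ (i, l) * (X S (Suc k) $ l - xs $ l))
        + \<beta> * ((X S (Suc k) $ i - xs $ i) - (X S k $ i - xs $ i))"
      unfolding eq by simp
  qed
  also have "\<dots> = d (Suc k) $ i - \<omega> * (\<Sum>l = 0..<n. mean_proj A s $$ (i, l) * d (Suc k) $ l)
      + \<beta> * (d (Suc k) $ i - E (Suc k) (\<lambda>S. X S k $ i - xs $ i))"
    unfolding E_linear(1) E_linear(2)[of "Suc k" "\<lambda>S. X S (Suc k) $ i - xs $ i"]
      E_linear(2)[of "Suc k" "\<lambda>S. X S (Suc k) $ i - xs $ i - \<omega> * (\<Sum>l = 0..<n. mean_proj A s $$ (i, l) * (X S (Suc k) $ l - xs $ l))"]
      E_linear(3) E_sum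
    by (simp add: d_def error_index i)
  \<comment> \<open>\<open>E (Suc k)\<close> also averages over draw \<open>k\<close>, which the
    iterate of index \<open>k\<close> ignores.\<close>
  also have "E (Suc k) (\<lambda>S. X S k $ i - xs $ i) = d k $ i"
    unfolding d_def error_index[OF i]
  proof (rule E_Suc_indep)
    fix S :: "nat \<Rightarrow> nat set" and T
    have "X (S(k := T)) k = X S k" by (rule iter_x_cong) simp
    thus "X (S(k := T)) k $ i - xs $ i = X S k $ i - xs $ i" by simp
  qed
  also have "(\<Sum>l = 0..<n. mean_proj A s $$ (i, l) * d (Suc k) $ l) = (mean_proj A s *\<^sub>v d (Suc k)) $ i"
    using H i d[THEN carrier_vecD] by (simp add: scalar_prod_def)
  finally show "d (Suc (Suc k)) $ i = (d (Suc k) - \<omega> \<cdot>\<^sub>v (mean_proj A s *\<^sub>v d (Suc k))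
      + \<beta> \<cdot>\<^sub>v (d (Suc k) - d k)) $ i"
    using i H d[THEN carrier_vecD] by simp
qed

end

end


section \<open>Convergence\<close>

text \<open>Each component of the product is a fixed finite combination of coordinates of order
  \<open>sqrt (\<beta> ^ k)\<close>.\<close>

lemma norm2_sq_mult_mat_vec_bound:
  assumes B: "B \<in> carrier_mat n m" and v: "\<And>k. v k \<in> carrier_vec m" and \<beta>: "0 \<le> \<beta>"
    and bound: "\<And>j. j < m \<Longrightarrow> \<exists>C\<ge>0. \<forall>k. (v k $ j)\<^sup>2 \<le> C * \<beta> ^ k"
  shows "\<exists>c>0. \<forall>k. norm2_sq (B *\<^sub>v v k) \<le> \<beta> ^ k * c"
proof -
  obtain C where C: "\<And>j. j < m \<Longrightarrow> C j \<ge> 0" "\<And>j k. j < m \<Longrightarrow> (v k $ j)\<^sup>2 \<le> C j * \<beta> ^ k"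
    using bound by metis
  define K where "K i = (\<Sum>j=0..<m. \<bar>B $$ (i, j)\<bar> * sqrt (C j))" for i
  \<comment> \<open>Adding 1 keeps the constant positive if every \<open>K i\<close>
    vanishes.\<close>
  have "norm2_sq (B *\<^sub>v v k) \<le> \<beta> ^ k * ((\<Sum>i<n. (K i)\<^sup>2) + 1)" for k
  proof -
    have "\<bar>(B *\<^sub>v v k) $ i\<bar> \<le> K i * sqrt (\<beta> ^ k)" if "i < n" for i
    proof -
      have "(B *\<^sub>v v k) $ i = (\<Sum>j=0..<m. B $$ (i, j) * v k $ j)"
        using B v[of k] that by (simp add: scalar_prod_def)
      also have "\<bar>\<dots>\<bar> \<le> (\<Sum>j=0..<m. \<bar>B $$ (i, j)\<bar> * \<bar>v k $ j\<bar>)"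
        by (rule order_trans[OF sum_abs]) (simp add: abs_mult)
      also have "\<dots> \<le> (\<Sum>j=0..<m. \<bar>B $$ (i, j)\<bar> * (sqrt (C j) * sqrt (\<beta> ^ k)))"
      proof (intro sum_mono mult_left_mono)
        fix j assume "j \<in> {0..<m}"
        hence "sqrt ((v k $ j)\<^sup>2) \<le> sqrt (C j * \<beta> ^ k)"
          using C(2)[of j k] by (intro real_sqrt_le_mono) auto
        thus "\<bar>v k $ j\<bar> \<le> sqrt (C j) * sqrt (\<beta> ^ k)" by (simp add: real_sqrt_mult)
      qed simp
      also have "\<dots> = K i * sqrt (\<beta> ^ k)" by (simp add: K_def sum_distrib_right mult.assoc)
      finally show ?thesis .
    qed
    hence sq: "((B *\<^sub>v v k) $ i)\<^sup>2 \<le> (K i)\<^sup>2 * \<beta> ^ k" if "i < n" for i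
      using power_mono[of "\<bar>(B *\<^sub>v v k) $ i\<bar>" "K i * sqrt (\<beta> ^ k)" 2] that \<beta>
      by (simp add: power_mult_distrib)
    have "dim_vec (B *\<^sub>v v k) = n" using B by simp
    hence "norm2_sq (B *\<^sub>v v k) \<le> (\<Sum>i<n. (K i)\<^sup>2 * \<beta> ^ k)"
      unfolding norm2_sq_def using sq by (simp only:) (rule sum_mono, simp)
    also have "\<dots> = \<beta> ^ k * (\<Sum>i<n. (K i)\<^sup>2)" by (simp add: sum_distrib_left mult.commute)
    also have "\<dots> \<le> \<beta> ^ k * ((\<Sum>i<n. (K i)\<^sup>2) + 1)"
      using \<beta> by (intro mult_left_mono) auto
    finally show ?thesis .
  qed
  moreover have "(\<Sum>i<n. (K i)\<^sup>2) + 1 > 0"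
    by (rule add_nonneg_pos) (auto intro: sum_nonneg)
  ultimately show ?thesis by blast
qed

text \<open>Here \<mu> is an eigenvalue of the expected projection. The upper bound combines the
  step size condition with \<open>weighted_esym_le\<close>; the lower one is
  \<open>weighted_esym_ge\<close> divided by positive sums.\<close>

lemma relaxed_eigenvalue_bounds:
  fixes l :: "nat \<Rightarrow> real"
  assumes nonneg: "\<And>i. i < m \<Longrightarrow> l i \<ge> 0" and anti: "\<And>i j. i \<le> j \<Longrightarrow> j < m \<Longrightarrow> l j \<le> l i"
    and s: "1 \<le> s" "s \<le> r" "r \<le> m"
    and pos: "\<And>i. i < r \<Longrightarrow> l i \<noteq> 0" and zero: "\<And>i. r \<le> i \<Longrightarrow> i < m \<Longrightarrow> l i = 0"
    and \<omega>: "0 < \<omega>" "\<omega> \<le> esym l {0..<m} s / (esym l {0..<m - 1} (s - 1) * l 0)"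
    and j: "j < r"
  defines "\<mu> \<equiv> l j * esym l ({0..<m} - {j}) (s - 1) / esym l {0..<m} s"
  shows "esym l {0..<m} s > 0" and "\<omega> * \<mu> \<le> 1" and "l (r - 1) / (\<Sum>i=s - 1..<r. l i) \<le> \<mu>"
proof -
  \<comment> \<open>Outside \<open>{0..<m}\<close> nothing is known of \<open>l\<close>; extension
    by 0 gives nonnegativity at every index, as the inequalities for \<open>esym\<close>
    demand.\<close>
  define f where "f i = (if i < m then l i else 0)" for i
  have f_nonneg: "f i \<ge> 0" for i using nonneg by (simp add: f_def)
  have f_anti: "f j \<le> f i" if "i \<le> j" "j < m" for i j using that anti by (simp add: f_def)
  have esym_f: "esym l N k = esym f N k" if "N \<subseteq> {0..<m}" for N k
    using that by (intro esym_cong) (auto simp: f_def)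
  let ?Z = "esym f {0..<m} s" and ?E = "esym f {0..<m - 1} (s - 1)"
    and ?e = "esym f ({0..<m} - {j}) (s - 1)" and ?S = "\<Sum>i=s - 1..<r. f i"
  have eqs: "esym l {0..<m} s = ?Z" "esym l {0..<m - 1} (s - 1) = ?E"
    "esym l ({0..<m} - {j}) (s - 1) = ?e" "l 0 = f 0" "l j = f j" "l (r - 1) = f (r - 1)"
    using s j by (auto intro!: esym_f simp: f_def)
  have S_eq: "(\<Sum>i=s - 1..<r. l i) = ?S" using s by (intro sum.cong) (auto simp: f_def)
  have Z0: "?Z \<ge> 0" and E0: "?E * f 0 \<ge> 0"
    by (rule esym_nonneg[OF f_nonneg] mult_nonneg_nonneg[OF esym_nonneg[OF f_nonneg] f_nonneg])+
  \<comment> \<open>Division by 0 yields 0, so a ratio that is at least the positive \<omega> has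
    nonzero numerator and denominator.\<close>
  have ratio: "0 < ?Z / (?E * f 0)" using \<omega> unfolding eqs by linarith
  hence Z: "?Z > 0" and E: "?E * f 0 > 0"
    using Z0 E0 by (auto simp: zero_less_divide_iff)
  show "esym l {0..<m} s > 0" using Z unfolding eqs .
  have "\<omega> * (f j * ?e) \<le> \<omega> * (f 0 * ?E)"
  proof (rule mult_left_mono)
    show "f j * ?e \<le> f 0 * ?E"
      by (rule weighted_esym_le[OF f_nonneg _ s(1)]) (use f_anti j s in auto)
  qed (use \<omega> in simp)
  also have "\<dots> \<le> ?Z" using \<omega>(2) E unfolding eqs by (simp add: field_simps)
  finally show "\<omega> * \<mu> \<le> 1" unfolding \<mu>_def eqs using Z by (simp add: field_simps)
  have "f (r - 1) > 0"
    using pos[of "r - 1"] f_nonneg[of "r - 1"] j s by (simp add: f_def split: if_splits)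
  moreover have "f (r - 1) \<le> ?S"
    by (rule member_le_sum) (use s j f_nonneg in auto)
  ultimately have S: "?S > 0" by simp
  have "f (r - 1) * ?Z \<le> f j * ?e * ?S"
    by (rule weighted_esym_ge[OF f_nonneg f_anti s(1) j s(3)]) (use zero in \<open>simp_all add: f_def\<close>)
  thus "l (r - 1) / (\<Sum>i=s - 1..<r. l i) \<le> \<mu>"
    unfolding \<mu>_def S_eq eqs using Z S by (simp add: field_simps)
qed

theorem theorem4p2:
  fixes A :: "real mat" and b x0 :: "real vec" and m n s :: nat and \<omega> \<beta> :: real
  assumes "A \<in> carrier_mat m n" and "b \<in> carrier_vec m" and "x0 \<in> carrier_vec n"
    and "\<exists>x \<in> carrier_vec n. A *\<^sub>v x = b"
    and "1 \<le> s" and "s \<le> mrank A"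
    and "0 < \<omega>"
    and "\<omega> \<le> elem_sym (sq_sv_list A) s /
               (elem_sym (butlast (sq_sv_list A)) (s - 1) * (spec_norm A)\<^sup>2)"
    and "(1 - sqrt (\<omega> * rho A s))\<^sup>2 < \<beta>" and "\<beta> < 1"
  shows "\<exists>c > 0. \<forall>k. norm2_sq (exp_iter A b s \<omega> \<beta> x0 k
             - (pinv A *\<^sub>v b + (1\<^sub>m n - pinv A * A) *\<^sub>v x0)) \<le> \<beta> ^ k * c"
proof -
  note A = assms(1) and b = assms(2) and x0 = assms(3) and s1 = assms(5) and \<omega>0 = assms(7)
  obtain xh where xh: "xh \<in> carrier_vec n" and Axh: "A *\<^sub>v xh = b" using assms(4) by auto

  \<comment> \<open>Spectrum, rank and eigenvalue bounds\<close>
  obtain W where W: "W \<in> carrier_mat m m" and WW: "W\<^sup>T * W = 1\<^sub>m m" and WW': "W * W\<^sup>T = 1\<^sub>m m"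
    and D: "W\<^sup>T * (A * A\<^sup>T) * W = diag_of (sq_sv_list A)"
    using gram_spectral[OF A] by metis
  let ?l = "\<lambda>i. sq_sv_list A ! i"
  have len: "length (sq_sv_list A) = m" by (rule length_sq_sv_list[OF A])
  have nonneg: "?l i \<ge> 0" if "i < m" for i by (rule sq_sv_list_nonneg[OF A W WW WW' D that])
  note anti = sq_sv_list_antimono[OF A]

  \<comment> \<open>The position of the first zero in the decreasing list, or the length if there is
    none; it counts the nonzero eigenvalues.\<close>
  define r where "r = (LEAST i. i = m \<or> ?l i = 0)"
  have rm: "r \<le> m" unfolding r_def by (rule Least_le) simp
  have r_or: "r = m \<or> ?l r = 0" unfolding r_def by (rule LeastI[of _ m]) simp
  have nz: "?l i \<noteq> 0" if "i < r" for i using not_less_Least[OF that[unfolded r_def]] by simp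
  have z: "?l i = 0" if "r \<le> i" "i < m" for i
    using r_or anti[OF that] nonneg[OF that(2)] that by auto
  have rank: "mrank A = r" by (rule mrank_eq[OF A W WW WW' D rm nz z])
  have sr: "s \<le> r" and sm: "s \<le> m" using assms(6) rank rm by auto

  \<comment> \<open>\<open>sing_val\<close> counts from 1 and the list from 0; nonnegativity lets
    the square undo the root.\<close>
  have sv: "(sing_val A i)\<^sup>2 = ?l (i - 1)" if "1 \<le> i" "i \<le> m" for i
    using nonneg[of "i - 1"] that by (simp add: sing_val_def)
  have \<omega>: "\<omega> \<le> esym ?l {0..<m} s / (esym ?l {0..<m - 1} (s - 1) * ?l 0)"
    using assms(8) sv[of 1] s1 sm unfolding elem_sym_butlast
    unfolding elem_sym_eq_esym len spec_norm_def by simp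
  note bounds = relaxed_eigenvalue_bounds[of m ?l s r \<omega>, OF _ _ s1 sr rm _ _ \<omega>0 \<omega>]
  have rho: "rho A s = ?l (r - 1) / (\<Sum>i=s - 1..<r. ?l i)"
  proof -
    have "(\<Sum>i=s..r. (sing_val A i)\<^sup>2) = (\<Sum>i=s..r. ?l (i - 1))"
      by (intro sum.cong refl sv) (use s1 rm in auto)
    also have "\<dots> = (\<Sum>i=s - 1..<r. ?l i)"
      by (rule sum.reindex_bij_witness[of _ Suc "\<lambda>i. i - 1"]) (use s1 in auto)
    finally show ?thesis
      unfolding rho_def rank using sv[of r] s1 sr rm by simp
  qed
  define \<mu> where "\<mu> j = ?l j * esym ?l ({0..<m} - {j}) (s - 1) / esym ?l {0..<m} s" for j
  have Z: "esym ?l {0..<m} s > 0" using bounds(1)[of 0] nonneg anti nz z s1 sr by simp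
  have \<mu>_le: "\<omega> * \<mu> j \<le> 1" if "j < r" for j
    unfolding \<mu>_def by (rule bounds(2)) (use nonneg anti nz z that in auto)
  have \<mu>_ge: "rho A s \<le> \<mu> j" if "j < r" for j
    unfolding rho \<mu>_def by (rule bounds(3)) (use nonneg anti nz z that in auto)
  have prob: "(\<Sum>T\<in>subsets_card m s. vol_prob A s T) = 1"
    using Z sum_vol_prob_dets[OF A W WW WW' D sm] A
    by (simp add: vol_prob_def flip: sum_divide_distrib)

  \<comment> \<open>The reference solution\<close>
  let ?P = "pinv A * A"
  define xs where "xs = pinv A *\<^sub>v b + (1\<^sub>m n - ?P) *\<^sub>v x0"
  have J: "pinv A \<in> carrier_mat n m" by (rule pinv_carrier[OF A])
  have P: "?P \<in> carrier_mat n n" by (rule mult_carrier_mat[OF J A])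
  have AP: "A * ?P = A" by (rule mult_pinv_mult[OF A])
  have PP: "?P * ?P = ?P" using assoc_mult_mat[OF J A P] AP by simp
  have xs: "xs \<in> carrier_vec n" unfolding xs_def
    by (rule add_carrier_vec[OF mult_mat_vec_carrier[OF J b]
          mult_mat_vec_carrier[OF minus_carrier_mat[OF P] x0]])
  have Jb: "pinv A *\<^sub>v b = ?P *\<^sub>v xh" unfolding Axh[symmetric] by (rule assoc_mult_mat_vec[symmetric, OF J A xh])
  have "(1\<^sub>m n - ?P) *\<^sub>v x0 = x0 - ?P *\<^sub>v x0"
    using minus_mult_distrib_mat_vec[OF one_carrier_mat P x0] x0 by simp
  moreover have "x0 - (q + (x0 - p)) = p - q" if "p \<in> carrier_vec n" "q \<in> carrier_vec n" for p q
    using that x0 by (intro eq_vecI) auto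
  \<comment> \<open>The initial error is the projection of \<open>x0 - xh\<close> onto the range of
    \<open>A\<^sup>T\<close>. This yields both that \<open>xs\<close> solves the system and that the
    error starts in that range.\<close>
  ultimately have err0: "x0 - xs = ?P *\<^sub>v (x0 - xh)"
    unfolding xs_def Jb mult_minus_distrib_mat_vec[OF P x0 xh]
    by (simp only: mult_mat_vec_carrier[OF P x0] mult_mat_vec_carrier[OF P xh])
  have APv: "A *\<^sub>v (?P *\<^sub>v x) = A *\<^sub>v x" if "x \<in> carrier_vec n" for x
    using assoc_mult_mat_vec[OF A P that] AP by simp
  have sol: "A *\<^sub>v xs = b"
  proof -
    have e: "x0 - xh \<in> carrier_vec n" using x0 xh by simp
    have "A *\<^sub>v x0 - A *\<^sub>v xs = A *\<^sub>v x0 - A *\<^sub>v xh"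
      unfolding mult_minus_distrib_mat_vec[OF A x0 xs, symmetric] err0 APv[OF e]
      by (rule mult_minus_distrib_mat_vec[OF A x0 xh])
    hence eq: "A *\<^sub>v x0 - A *\<^sub>v xs = A *\<^sub>v x0 - b" unfolding Axh .
    have "(A *\<^sub>v xs) $ i = b $ i" if "i < m" for i
      using arg_cong[OF eq, of "\<lambda>v. v $ i"] that A b by simp
    thus ?thesis using A b by (intro eq_vecI) auto
  qed

  \<comment> \<open>Recursion for the expected error\<close>
  define d where "d k = exp_iter A b s \<omega> \<beta> x0 k - xs" for k
  have d: "d k \<in> carrier_vec n" for k
    using exp_iter_carrier[OF A] xs by (simp add: d_def)
  have d01: "d 0 = x0 - xs" "d (Suc 0) = x0 - xs"
    using exp_iter_0_1[OF A x0] by (auto simp: d_def)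
  have rec: "d (Suc (Suc k)) = d (Suc k) - \<omega> \<cdot>\<^sub>v (mean_proj A s *\<^sub>v d (Suc k)) + \<beta> \<cdot>\<^sub>v (d (Suc k) - d k)" for k
    unfolding d_def by (rule exp_iter_error_rec[OF A x0 xs sol prob])
  have H: "mean_proj A s \<in> carrier_mat n n" by (rule mean_proj_carrier[OF A])
  have Hv: "mean_proj A s *\<^sub>v d k \<in> carrier_vec n" for k by (rule mult_mat_vec_carrier[OF H d])
  \<comment> \<open>Applied with the projector, for invariance of the range, and with the map to
    eigencoordinates.\<close>
  have lin: "B *\<^sub>v d (Suc (Suc k)) = B *\<^sub>v d (Suc k) - \<omega> \<cdot>\<^sub>v (B *\<^sub>v (mean_proj A s *\<^sub>v d (Suc k)))
      + \<beta> \<cdot>\<^sub>v (B *\<^sub>v d (Suc k) - B *\<^sub>v d k)" if B: "B \<in> carrier_mat p n" for B p k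
  proof -
    have 1: "\<omega> \<cdot>\<^sub>v (mean_proj A s *\<^sub>v d (Suc k)) \<in> carrier_vec n" using Hv by simp
    have 2: "d (Suc k) - d k \<in> carrier_vec n" using d by simp
    show ?thesis
      unfolding rec mult_add_distrib_mat_vec[OF B minus_carrier_vec[OF d 1] smult_carrier_vec[THEN iffD2, OF 2]]
        mult_minus_distrib_mat_vec[OF B d 1] mult_mat_vec[OF B Hv] mult_mat_vec[OF B 2]
        mult_minus_distrib_mat_vec[OF B d d] ..
  qed
  have "?P *\<^sub>v (x0 - xs) = x0 - xs"
    unfolding err0 using assoc_mult_mat_vec[OF P P, of "x0 - xh"] x0 xh PP by simp
  moreover have "?P *\<^sub>v (mean_proj A s *\<^sub>v d k) = mean_proj A s *\<^sub>v d k" for k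
    unfolding assoc_mult_mat_vec[OF P H d, symmetric] pinv_mult_mean_proj[OF A] ..
  \<comment> \<open>Two consecutive errors are carried along, as the recursion has order
    two.\<close>
  ultimately have range: "?P *\<^sub>v d k = d k \<and> ?P *\<^sub>v d (Suc k) = d (Suc k)" for k
    by (induction k) (simp_all add: d01 lin[OF P] flip: rec)

  \<comment> \<open>Decay in eigencoordinates\<close>
  let ?C = "W\<^sup>T * A"
  have WT: "W\<^sup>T \<in> carrier_mat m m" using W by simp
  have C: "?C \<in> carrier_mat m n" by (rule mult_carrier_mat[OF WT A])
  have "\<exists>K\<ge>0. \<forall>k. ((?C *\<^sub>v d k) $ j)\<^sup>2 \<le> K * \<beta> ^ k" if j: "j < m" for j
  proof (cases "j < r")
    case True
    have rho0: "0 \<le> \<omega> * rho A s"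
      unfolding rho using \<omega>0 nonneg rm s1 sr by (intro mult_nonneg_nonneg divide_nonneg_nonneg sum_nonneg) auto
    have ge: "\<omega> * rho A s \<le> \<omega> * \<mu> j" using \<mu>_ge[OF True] \<omega>0 by simp
    show ?thesis
    proof (rule heavy_ball_scalar_bound[where \<theta> = "\<omega> * \<mu> j"])
      fix k
      show "(?C *\<^sub>v d (Suc (Suc k))) $ j = (1 + \<beta> - \<omega> * \<mu> j) * (?C *\<^sub>v d (Suc k)) $ j - \<beta> * (?C *\<^sub>v d k) $ j"
      proof -
        have idx: "(p - \<omega> \<cdot>\<^sub>v q + \<beta> \<cdot>\<^sub>v (p - t)) $ j = p $ j - \<omega> * q $ j + \<beta> * (p $ j - t $ j)"
          if "p \<in> carrier_vec m" "q \<in> carrier_vec m" "t \<in> carrier_vec m" for p q t :: "real vec"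
          using that j by simp
        have "(?C *\<^sub>v d (Suc (Suc k))) $ j = (?C *\<^sub>v d (Suc k)) $ j
            - \<omega> * (?C *\<^sub>v (mean_proj A s *\<^sub>v d (Suc k))) $ j + \<beta> * ((?C *\<^sub>v d (Suc k)) $ j - (?C *\<^sub>v d k) $ j)"
          unfolding lin[OF C]
          by (rule idx[OF mult_mat_vec_carrier[OF C d] mult_mat_vec_carrier[OF C Hv]
                mult_mat_vec_carrier[OF C d]])
        also have "(?C *\<^sub>v (mean_proj A s *\<^sub>v d (Suc k))) $ j = \<mu> j * (?C *\<^sub>v d (Suc k)) $ j"
          unfolding \<mu>_def
          by (rule mean_proj_eigen_coordinate[OF A W WW WW' D d _ j s1 sm]) (use range in blast)
        finally show ?thesis by (simp add: algebra_simps)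
      qed
      show "0 \<le> \<omega> * \<mu> j" using rho0 ge by linarith
      show "\<omega> * \<mu> j \<le> 1" by (rule \<mu>_le[OF True])
      \<comment> \<open>On the unit interval \<open>(1 - sqrt t)\<^sup>2\<close> decreases in
        \<open>t\<close>, so the condition on \<beta> at the smaller argument
        \<open>\<omega> * rho A s\<close> covers every nonzero eigenvalue.\<close>
      have "(1 - sqrt (\<omega> * \<mu> j))\<^sup>2 \<le> (1 - sqrt (\<omega> * rho A s))\<^sup>2"
        using real_sqrt_le_mono[OF ge] \<mu>_le[OF True] by (intro power_mono) auto
      thus "(1 - sqrt (\<omega> * \<mu> j))\<^sup>2 < \<beta>" using assms(9) by linarith
      show "\<beta> < 1" by (rule assms(10))
    qed
  next
    case False
    \<comment> \<open>A zero eigenvalue makes row \<open>j\<close> of \<open>?C\<close> vanish, so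
      this coordinate of the error is 0 for all \<open>k\<close>.\<close>
    have "?C $$ (j, i) = 0" if "i < n" for i
      using row_norm_eq_sq_sv[OF A W WW WW' D j] z[of j] False j that
      by (simp add: sum_nonneg_eq_0_iff del: index_mult_mat)
    moreover have "(B *\<^sub>v v) $ j = 0" if "B \<in> carrier_mat m n" "v \<in> carrier_vec n"
      "\<And>i. i < n \<Longrightarrow> B $$ (j, i) = 0" for B v
      using that j by (simp add: scalar_prod_def)
    ultimately have "(?C *\<^sub>v d k) $ j = 0" for k using C d by blast
    thus ?thesis by (intro exI[of _ 0]) simp
  qed
  moreover have "\<beta> > 0" using assms(9) by (smt (verit) zero_le_power2)
  ultimately have "\<exists>c>0. \<forall>k. norm2_sq ((pinv A * W) *\<^sub>v (?C *\<^sub>v d k)) \<le> \<beta> ^ k * c"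
    by (intro norm2_sq_mult_mat_vec_bound[of _ n m] mult_mat_vec_carrier[OF C d] mult_carrier_mat[OF J W]) auto
  \<comment> \<open>The factor \<open>pinv A * W\<close> undoes \<open>?C\<close> on the range of
    \<open>A\<^sup>T\<close>, where \<open>pinv A * A\<close> acts as the identity.\<close>
  moreover have "(pinv A * W) *\<^sub>v (?C *\<^sub>v d k) = d k" for k
  proof -
    have "(pinv A * W) * ?C = pinv A * (W * W\<^sup>T) * A"
      using A W J by (simp add: mat_mult_assoc_dim)
    also have "\<dots> = ?P" unfolding WW' using J by (simp add: one_mult_mat_dim)
    finally show ?thesis
      using assoc_mult_mat_vec[OF mult_carrier_mat[OF J W] C d] range by simp
  qed
  ultimately show ?thesis by (simp add: d_def xs_def)
qed

end
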